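(* Let $m\in\mathbb{N}$ and $d\ge 2$. There are constants $c_1,c_2>0$ depending only on $m$ and $d$ such that for every $\eta\in\mathbb{S}^{d-1}$ and every $0<\varepsilon\le1$ the following holds. Set $a:=1+\varepsilon$, $\delta:=1-a^{-2}$, and $$\mathcal{F}_\varepsilon(t):=\frac{(d/2)_{m-1}}{2\,m!}a^{2m}\delta^{2m-1}(a^2+1-2at)^{-d/2+1-m},\quad t\in[-1,1].$$ Then $$\mathcal{F}_\varepsilon(x\cdot\eta)=\frac{(d/2)_{m-1}}{2\,m!}a^{2m}\delta^{2m-1}|x-a\eta|^{-d+2-2m},\quad x\in\mathbb{S}^{d-1},$$ $$0<\mathcal{F}_\varepsilon(x\cdot\eta)\le\frac{c_1\varepsilon^{-d+1}}{(1+\varepsilon^{-1}\rho(x,\eta))^{2m+d-2}},\quad x\in\mathbb{S}^{d-1},$$ and $$\int_{\mathbb{S}^{d-1}}\mathcal{F}_\varepsilon(x\cdot\eta)\,d\sigma(x)\ge c_2>0.$$ Furthermore, $\mathcal{F}_\varepsilon(x\cdot\eta)$ is the restriction to $\mathbb{S}^{d-1}$ of the harmonic function, defined for $x\in\mathbb{R}^d\setminus\{a\eta\}$, $$H_{\varepsilon,m}(a\eta,x):=q_0|x-a\eta|^{2-d}+\sum_{\ell=1}^m\frac{q_\ell\,\delta^{\ell-1}a^\ell}{\ell!\,(d-2)}(\eta\cdot\nabla)^\ell|x-a\eta|^{2-d}\quad\text{if }d\ge3,$$ or $$H_{\varepsilon,m}(a\eta,x):=q_0+\sum_{\ell=1}^m\frac{q_\ell\,\delta^{\ell-1}a^\ell}{\ell!}(\eta\cdot\nabla)^\ell\ln\frac{1}{|x-a\eta|}\quad\text{if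 }d=2,$$ where the coefficients $q_0,\dots,q_m$ are determined as the solution of the linear system of $m+1$ equations $$q_0+\sum_{\ell=1}^m(d/2)_{\ell-1}\frac{\delta^{\ell-1}}{2\,\ell!}q_\ell=0,$$ $$\sum_{\ell=0}^{m-\nu}\Big[\sum_{k=(\ell-\nu)_+}^{\ell}(-1)^{\ell-k}\binom{\nu}{\ell-k}(d/2+\nu-1)_k\frac{\delta^k}{k!}\Big]q_{\nu+\ell}=0,\quad\nu=1,\dots,m-1,$$ $$q_m=1.$$
   Context: $|\cdot|$ is the Euclidean norm and $x\cdot y$ the dot product on $\mathbb{R}^d$; $\mathbb{S}^{d-1}$ is the unit sphere in $\mathbb{R}^d$; $\rho(x,\eta):=\arccos(x\cdot\eta)$ is the geodesic distance on $\mathbb{S}^{d-1}$; $\sigma$ is the Lebesgue (surface) measure on $\mathbb{S}^{d-1}$. $(\eta\cdot\nabla)^\ell$ is the $\ell$th directional derivative (in $x$) in direction $\eta$. $(u)_0:=1$, $(u)_k:=u(u+1)\cdots(u+k-1)$ is the Pochhammer symbol, and $(u)_+:=\max\{0,u\}$. *)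

theory Defs
  imports "HOL-Analysis.Analysis"
begin

text \<open>
  Lebesgue surface measure, in its polar-coordinate form: the measure of a Borel subset \<open>A\<close> of the
  sphere is \<open>d\<close> times the volume of the cone \<open>{r u | 0 < r \<le> 1, u \<in> A}\<close>. It is not normalised; its
  total mass is \<open>d\<close> times the volume of the unit ball.
\<close>

definition sphere_measure :: "'a::euclidean_space measure" where
  "sphere_measure =
     scale_measure (of_nat DIM('a))
       (distr (restrict_space lborel (cball 0 1 - {0})) (restrict_space borel (sphere 0 1))
          (\<lambda>x. x /\<^sub>R norm x))"

lemma normalize_measurable:
  "(\<lambda>x::'a::euclidean_space. x /\<^sub>R norm x)
     \<in> restrict_space lborel (cball 0 1 - {0}) \<rightarrow>\<^sub>M restrict_space borel (sphere 0 1)"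
  by (rule measurable_restrict_space2, force simp: space_restrict_space,
      rule measurable_restrict_space1, measurable)

lemma space_sphere_measure [simp]:
  "space (sphere_measure :: 'a::euclidean_space measure) = sphere 0 1"
  by (simp add: sphere_measure_def space_scale_measure space_restrict_space)

lemma sets_sphere_measure [measurable_cong]:
  "sets (sphere_measure :: 'a::euclidean_space measure) = sets (restrict_space borel (sphere 0 1))"
  by (simp add: sphere_measure_def)

lemma emeasure_sphere_measure:
  fixes A :: "'a::euclidean_space set"
  assumes "A \<in> sets sphere_measure"
  shows "emeasure sphere_measure A =
    of_nat DIM('a) * emeasure lborel {x. 0 < norm x \<and> norm x \<le> 1 \<and> x /\<^sub>R norm x \<in> A}"
proof -
  have A: "A \<in> sets (restrict_space borel (sphere 0 1))"
    using assms by (simp add: sets_sphere_measure)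
  have "(\<lambda>x. x /\<^sub>R norm x) -` A \<inter> space (restrict_space lborel (cball 0 1 - {0}))
      = {x. 0 < norm x \<and> norm x \<le> 1 \<and> x /\<^sub>R norm x \<in> A}"
    by (auto simp: space_restrict_space)
  then show ?thesis
    by (simp add: sphere_measure_def emeasure_distr[OF normalize_measurable A]
        emeasure_restrict_space Collect_mono_iff subset_eq)
qed

definition geodesic_dist :: "'a::euclidean_space \<Rightarrow> 'a \<Rightarrow> real" where
  "geodesic_dist x y = arccos (x \<bullet> y)"


text \<open>The iterate \<open>(dir_deriv v ^^ l) f\<close> is \<open>(v \<cdot> \<nabla>)\<^sup>l f\<close>.\<close>

definition dir_deriv :: "'a::real_normed_vector \<Rightarrow> ('a \<Rightarrow> real) \<Rightarrow> 'a \<Rightarrow> real" where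
  "dir_deriv v f x = deriv (\<lambda>s. f (x + s *\<^sub>R v)) 0"

text \<open>
  \<open>dir_deriv\<close> is total, so existence of the derivatives is required separately; on an open set the
  following says precisely that \<open>f\<close> is of class \<open>C\<^sup>2\<close>.
\<close>

definition C2_on :: "('a::euclidean_space \<Rightarrow> real) \<Rightarrow> 'a set \<Rightarrow> bool" where
  "C2_on f S \<longleftrightarrow>
     (\<forall>x\<in>S. f differentiable (at x)) \<and>
     (\<forall>b\<in>Basis. \<forall>x\<in>S. dir_deriv b f differentiable (at x)) \<and>
     (\<forall>b\<in>Basis. \<forall>c\<in>Basis. continuous_on S (dir_deriv c (dir_deriv b f)))"

definition laplacian :: "('a::euclidean_space \<Rightarrow> real) \<Rightarrow> 'a \<Rightarrow> real" where
  "laplacian f x = (\<Sum>b\<in>Basis. (dir_deriv b ^^ 2) f x)"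

definition harmonic_on :: "('a::euclidean_space \<Rightarrow> real) \<Rightarrow> 'a set \<Rightarrow> bool" where
  "harmonic_on f S \<longleftrightarrow> open S \<and> C2_on f S \<and> (\<forall>x\<in>S. laplacian f x = 0)"


text \<open>\<open>d\<close> is the dimension of the ambient space.\<close>

definition kernel_F :: "nat \<Rightarrow> nat \<Rightarrow> real \<Rightarrow> real \<Rightarrow> real" where
  "kernel_F d m \<epsilon> t =
     (let a = 1 + \<epsilon>; \<delta> = 1 - 1 / a ^ 2 in
        pochhammer (real d / 2) (m - 1) / (2 * fact m) * a ^ (2 * m) * \<delta> ^ (2 * m - 1) *
        (a ^ 2 + 1 - 2 * a * t) powr (- real d / 2 + 1 - real m))"

text \<open>In the lower summation bound, truncated subtraction renders \<open>(l - \<nu>)\<^sub>+\<close>.\<close>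

definition coeff_system :: "nat \<Rightarrow> nat \<Rightarrow> real \<Rightarrow> (nat \<Rightarrow> real) \<Rightarrow> bool" where
  "coeff_system d m \<delta> q \<longleftrightarrow>
     q 0 + (\<Sum>l=1..m. pochhammer (real d / 2) (l - 1) * (\<delta> ^ (l - 1) / (2 * fact l)) * q l) = 0 \<and>
     (\<forall>\<nu>\<in>{1..m - 1}.
        (\<Sum>l=0..m - \<nu>.
           (\<Sum>k=l - \<nu>..l.
              (- 1) ^ (l - k) * real (\<nu> choose (l - k)) *
              pochhammer (real d / 2 + real \<nu> - 1) k * (\<delta> ^ k / fact k)) * q (\<nu> + l)) = 0) \<and>
     q m = 1"

definition harmonic_H ::
    "nat \<Rightarrow> nat \<Rightarrow> real \<Rightarrow> (nat \<Rightarrow> real) \<Rightarrow> 'a::euclidean_space \<Rightarrow> 'a \<Rightarrow> real" where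
  "harmonic_H d m \<epsilon> q \<eta> x =
     (let a = 1 + \<epsilon>; \<delta> = 1 - 1 / a ^ 2 in
        if d = 2 then
          q 0 + (\<Sum>l=1..m. q l * \<delta> ^ (l - 1) * a ^ l / fact l *
                   (dir_deriv \<eta> ^^ l) (\<lambda>y. ln (1 / norm (y - a *\<^sub>R \<eta>))) x)
        else
          q 0 * norm (x - a *\<^sub>R \<eta>) powi (2 - int d) +
          (\<Sum>l=1..m. q l * \<delta> ^ (l - 1) * a ^ l / (fact l * (real d - 2)) *
             (dir_deriv \<eta> ^^ l) (\<lambda>y. norm (y - a *\<^sub>R \<eta>) powi (2 - int d)) x))"

end

theory Submission
  imports Defs
begin

text \<open>
Throughout \<open>\<lambda> = d/2 - 1\<close>, \<open>a = 1 + \<epsilon>\<close>, \<open>\<delta> = 1 - a\<^sup>-\<^sup>2\<close> and \<open>r = |x - a \<eta>|\<close>. The closed form of the kernel on the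
sphere is the identity \<open>r\<^sup>2 = a\<^sup>2 + 1 - 2 a (x \<bullet> \<eta>)\<close>. The upper bound follows from \<open>\<delta> \<le> 2 \<epsilon>\<close> and
\<open>r \<ge> (\<epsilon> + \<rho>(x,\<eta>)) / 4\<close>. For the lower bound of the integral, the kernel is at least a multiple of \<open>\<epsilon>\<^sup>1\<^sup>-\<^sup>d\<close>
on the cap \<open>|x - \<eta>| \<le> \<epsilon>\<close>, and the measure of this cap is at least a multiple of \<open>\<epsilon>\<^sup>d\<^sup>-\<^sup>1\<close>
(\<open>measure_spherical_cap_ge\<close>), because the cone over it contains about \<open>1 / \<epsilon>\<close> disjoint balls of radius
\<open>\<epsilon> / 8\<close>.

The linear system is triangular with unit diagonal, hence uniquely solvable. The function \<open>H\<close> is harmonic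
because the fundamental solution is, and directional derivatives commute with the Laplacian.

The main point is that \<open>H\<close> equals the kernel on the sphere. For \<open>d \<ge> 3\<close> the numbers
\<open>(\<eta> \<cdot> \<nabla>)\<^sup>l |x - a \<eta>|\<^sup>2\<^sup>-\<^sup>d / l!\<close> are the Taylor coefficients in \<open>h\<close> of \<open>|x - a \<eta> + h \<eta>|\<^sup>2\<^sup>-\<^sup>d\<close>, and
\<open>|x - a \<eta> + h \<eta>|\<^sup>2 = r\<^sup>2 + 2 h ((x - a \<eta>) \<bullet> \<eta>) + h\<^sup>2\<close>. On the sphere \<open>2 a ((x - a \<eta>) \<bullet> \<eta>) = - (a\<^sup>2 \<delta> + r\<^sup>2)\<close>,
and the substitution \<open>h = a \<delta> w\<close> turns this quadratic polynomial into
\<open>r\<^sup>2 (1 - \<delta> w - A w (1 - w))\<close> with \<open>A = a\<^sup>2 \<delta>\<^sup>2 / r\<^sup>2\<close>. Expanding its power \<open>- \<lambda>\<close> (for \<open>d = 2\<close>, its logarithm) in powers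
of \<open>A w (1 - w) / (1 - \<delta> w)\<close>, the term of order \<open>\<nu>\<close> carries \<open>A\<^sup>\<nu>\<close>, that is \<open>r\<^sup>-\<^sup>2\<^sup>\<nu>\<close>, times the series
\<open>w\<^sup>\<nu> (1 - w)\<^sup>\<nu>\<close> times \<open>1 - \<delta> w\<close> to the power \<open>- (\<lambda> + \<nu>)\<close>, whose coefficients are the
inner sums of the linear system. So the equation with index \<open>\<nu>\<close> cancels the contribution of order \<open>\<nu>\<close>, and
\<open>q\<^sub>m = 1\<close> leaves the single term of order \<open>m\<close>, which is the kernel (\<open>coeff_system_sum\<close>).

To avoid analytic expansions, the Taylor coefficients are identified with those of the formal power
series by a recurrence: both sequences satisfy the one that comes from the first-order differential
equation of a power of a quadratic polynomial (\<open>dir_deriv_iterates_rec\<close>, \<open>taylor_fps_rec\<close>,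
\<open>dir_deriv_iterates_eq_taylor_fps\<close>).
\<close>

section \<open>Distances on the sphere\<close>

lemma norm_diff_scaleR_sphere:
  fixes x \<eta> :: "'a::euclidean_space"
  assumes "norm x = 1" "norm \<eta> = 1"
  shows "(norm (x - a *\<^sub>R \<eta>))\<^sup>2 = a\<^sup>2 + 1 - 2 * a * (x \<bullet> \<eta>)"
proof -
  have xx: "x \<bullet> x = 1" and \<eta>\<eta>: "\<eta> \<bullet> \<eta> = 1" using assms by (simp_all add: dot_square_norm)
  have "(norm (x - a *\<^sub>R \<eta>))\<^sup>2 = (x - a *\<^sub>R \<eta>) \<bullet> (x - a *\<^sub>R \<eta>)" by (simp add: dot_square_norm)
  also have "\<dots> = x \<bullet> x - 2 * a * (x \<bullet> \<eta>) + a\<^sup>2 * (\<eta> \<bullet> \<eta>)"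
    by (simp add: inner_diff_left inner_diff_right inner_commute power2_eq_square)
  finally show ?thesis unfolding xx \<eta>\<eta> by simp
qed

lemma one_minus_cos_ge:
  assumes "0 \<le> \<rho>" "\<rho> \<le> pi"
  shows "\<rho>\<^sup>2 / 8 \<le> 1 - cos \<rho>"
proof -
  define y where "y = \<rho> / 2"
  have y: "0 \<le> y" "y \<le> 8 / 5" using assms pi_approx by (simp_all add: y_def)
  have "\<bar>sin y - (\<Sum>m<3. sin_coeff m * y ^ m)\<bar> \<le> inverse (fact 3) * \<bar>y\<bar> ^ 3" by (rule Maclaurin_sin_bound)
  then have "\<bar>sin y - y\<bar> \<le> y ^ 3 / 6"
    using y by (simp add: sin_coeff_def eval_nat_numeral)
  then have "sin y \<ge> y - y ^ 3 / 6" by linarith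
  moreover have "y ^ 3 \<le> y * (8/5)\<^sup>2"
    using mult_left_mono[OF power_mono[OF y(2) y(1), of 2] y(1)] by (simp add: power3_eq_cube power2_eq_square mult.assoc)
  \<comment> \<open>\<open>1 - (8/5)\<^sup>2 / 6 \<ge> 1/2\<close>.\<close>
  ultimately have "sin y \<ge> y / 2" using y by (simp add: power2_eq_square)
  then have "(sin y)\<^sup>2 \<ge> (y / 2)\<^sup>2" using y by (intro power_mono) auto
  moreover have "cos \<rho> = 1 - 2 * (sin y)\<^sup>2" using cos_double_sin[of y] by (simp add: y_def)
  ultimately show ?thesis by (simp add: y_def power2_eq_square)
qed

lemma norm_diff_ge_geodesic:
  fixes x \<eta> :: "'a::euclidean_space"
  assumes "norm x = 1" "norm \<eta> = 1" "\<epsilon> > 0"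
  shows "(\<epsilon> + geodesic_dist x \<eta>) / 4 \<le> norm (x - (1 + \<epsilon>) *\<^sub>R \<eta>)"
proof -
  define \<rho> where "\<rho> = geodesic_dist x \<eta>"
  have t: "-1 \<le> x \<bullet> \<eta>" "x \<bullet> \<eta> \<le> 1"
    using Cauchy_Schwarz_ineq2[of x \<eta>] assms by auto
  have \<rho>: "0 \<le> \<rho>" "\<rho> \<le> pi" and c: "cos \<rho> = x \<bullet> \<eta>"
    using t by (auto simp: \<rho>_def geodesic_dist_def arccos_lbound arccos_ubound)
  have "(norm (x - (1 + \<epsilon>) *\<^sub>R \<eta>))\<^sup>2 = \<epsilon>\<^sup>2 + 2 * (1 + \<epsilon>) * (1 - cos \<rho>)"
    unfolding norm_diff_scaleR_sphere[OF assms(1,2)] c by (simp add: power2_eq_square algebra_simps)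
  also have "\<dots> \<ge> \<epsilon>\<^sup>2 + 2 * 1 * (\<rho>\<^sup>2 / 8)"
    using one_minus_cos_ge[OF \<rho>] assms(3) by (intro add_left_mono mult_mono) auto
  also have "\<epsilon>\<^sup>2 + 2 * 1 * (\<rho>\<^sup>2 / 8) \<ge> ((\<epsilon> + \<rho>) / 4)\<^sup>2"
  proof -
    have "((\<epsilon> + \<rho>) / 4)\<^sup>2 = (\<epsilon>\<^sup>2 + \<rho>\<^sup>2 + 2 * \<epsilon> * \<rho>) / 16"
      by (simp add: power2_eq_square algebra_simps)
    also have "\<dots> \<le> (\<epsilon>\<^sup>2 + \<rho>\<^sup>2 + (\<epsilon>\<^sup>2 + \<rho>\<^sup>2)) / 16"
      by (intro divide_right_mono add_left_mono sum_squares_bound) simp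
    also have "\<dots> \<le> \<epsilon>\<^sup>2 + 2 * 1 * (\<rho>\<^sup>2 / 8)" by simp
    finally show ?thesis .
  qed
  finally show ?thesis unfolding \<rho>_def by (rule power2_le_imp_le) simp
qed

lemma one_minus_inverse_square_bounds:
  fixes \<epsilon> :: real
  assumes "0 < \<epsilon>" "\<epsilon> \<le> 1"
  shows "3 / 4 * \<epsilon> \<le> 1 - 1 / (1 + \<epsilon>)\<^sup>2" "1 - 1 / (1 + \<epsilon>)\<^sup>2 \<le> 2 * \<epsilon>"
proof -
  have e: "1 - 1 / (1 + \<epsilon>)\<^sup>2 = \<epsilon> * (2 + \<epsilon>) / (1 + \<epsilon>)\<^sup>2"
  proof -
    have "1 - 1 / (1 + \<epsilon>)\<^sup>2 = ((1 + \<epsilon>)\<^sup>2 - 1) / (1 + \<epsilon>)\<^sup>2"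
      using assms by (simp add: diff_divide_distrib)
    also have "(1 + \<epsilon>)\<^sup>2 - 1 = \<epsilon> * (2 + \<epsilon>)" by (simp add: power2_eq_square algebra_simps)
    finally show ?thesis .
  qed
  have "\<epsilon>\<^sup>2 \<le> \<epsilon>" using assms by (simp add: power2_eq_square mult_left_le)
  then have "3 * (1 + \<epsilon>)\<^sup>2 \<le> 4 * (2 + \<epsilon>)" using assms by (simp add: power2_sum)
  then have "\<epsilon> * (3 * (1 + \<epsilon>)\<^sup>2) \<le> \<epsilon> * (4 * (2 + \<epsilon>))" using assms by (intro mult_left_mono) auto
  then show "3 / 4 * \<epsilon> \<le> 1 - 1 / (1 + \<epsilon>)\<^sup>2"
    unfolding e using assms by (simp add: field_simps)
  have "\<epsilon> * (2 + \<epsilon>) \<le> 2 * \<epsilon> * (1 + \<epsilon>)\<^sup>2"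
  proof -
    have "2 + \<epsilon> \<le> 2 * (1 + \<epsilon>)\<^sup>2" using assms by (simp add: power2_eq_square algebra_simps)
    then have "\<epsilon> * (2 + \<epsilon>) \<le> \<epsilon> * (2 * (1 + \<epsilon>)\<^sup>2)" using assms by (intro mult_left_mono) auto
    then show ?thesis by (simp only: mult_ac)
  qed
  then show "1 - 1 / (1 + \<epsilon>)\<^sup>2 \<le> 2 * \<epsilon>"
    unfolding e using assms by (simp add: divide_le_eq)
qed

section \<open>The measure of spherical caps\<close>

lemma finite_measure_sphere_measure: "finite_measure (sphere_measure :: 'a::euclidean_space measure)"
proof (rule finite_measureI)
  have "emeasure (sphere_measure :: 'a measure) (space sphere_measure) =
     of_nat DIM('a) * emeasure lborel {x::'a. 0 < norm x \<and> norm x \<le> 1 \<and> x /\<^sub>R norm x \<in> space sphere_measure}"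
    by (rule emeasure_sphere_measure) (rule sets.top)
  moreover have "emeasure lborel {x::'a. 0 < norm x \<and> norm x \<le> 1 \<and> x /\<^sub>R norm x \<in> space sphere_measure} < \<infinity>"
    by (intro emeasure_bounded_finite bounded_subset[OF bounded_cball[of 0 1]]) auto
  ultimately show "emeasure (sphere_measure :: 'a measure) (space sphere_measure) \<noteq> \<infinity>"
    by (simp add: ennreal_mult_eq_top_iff)
qed

lemma spherical_cap_measurable:
  "{x \<in> sphere 0 1. norm (x - \<eta>) \<le> \<epsilon>} \<in> sets (sphere_measure :: 'a::euclidean_space measure)"
proof -
  have "closed {x::'a. norm (x - \<eta>) \<le> \<epsilon>}" by (intro closed_Collect_le continuous_intros)
  moreover have "{x \<in> sphere 0 1. norm (x - \<eta>) \<le> \<epsilon>} = sphere 0 1 \<inter> {x::'a. norm (x - \<eta>) \<le> \<epsilon>}"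
    by auto
  ultimately show ?thesis by (auto simp: sets_sphere_measure sets_restrict_space)
qed

text \<open>
The measure of a cap of radius \<open>\<epsilon>\<close> is \<open>d\<close> times the volume of the cone over it. This cone contains
about \<open>1 / \<epsilon>\<close> disjoint balls of radius \<open>\<epsilon> / 8\<close> with centres on the segment from \<open>\<eta> / 2\<close> to
\<open>3 \<eta> / 4\<close>, so that its volume is at least a multiple of \<open>\<epsilon>\<^sup>d\<^sup>-\<^sup>1\<close>. No rotation invariance is
needed.
\<close>
lemma measure_spherical_cap_ge:
  fixes \<eta> :: "'a::euclidean_space"
  assumes \<eta>: "norm \<eta> = 1" and \<epsilon>: "0 < \<epsilon>" "\<epsilon> \<le> 1"
  shows "measure sphere_measure {x \<in> sphere 0 1. norm (x - \<eta>) \<le> \<epsilon>} \<ge>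
    real DIM('a) * unit_ball_vol (real DIM('a)) / (2 * 8 ^ DIM('a)) * \<epsilon> ^ (DIM('a) - 1)"
proof -
  define cap where "cap = {x \<in> sphere (0::'a) 1. norm (x - \<eta>) \<le> \<epsilon>}"
  define K where "K = {x::'a. 0 < norm x \<and> norm x \<le> 1 \<and> x /\<^sub>R norm x \<in> cap}"
  have cap: "cap \<in> sets sphere_measure" unfolding cap_def by (rule spherical_cap_measurable)
  define N where "N = nat \<lfloor>1 / \<epsilon>\<rfloor>"
  have N: "real N \<le> 1 / \<epsilon>" "1 / (2 * \<epsilon>) \<le> real N"
  proof -
    have "1 / \<epsilon> \<ge> 1" using \<epsilon> by simp
    then have "real N = of_int \<lfloor>1 / \<epsilon>\<rfloor>" "\<lfloor>1 / \<epsilon>\<rfloor> \<ge> 1" unfolding N_def by linarith+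
    then show "real N \<le> 1 / \<epsilon>" "1 / (2 * \<epsilon>) \<le> real N" by linarith+
  qed
  define t where "t k = 1 / 2 + real k * (\<epsilon> / 4)" for k :: nat
  define B where "B k = ball (t k *\<^sub>R \<eta>) (\<epsilon> / 8)" for k
  have t: "1 / 2 \<le> t k" "t k \<le> 3 / 4" if "k < N" for k
  proof -
    show "1 / 2 \<le> t k" using \<epsilon> by (simp add: t_def)
    have "real k * \<epsilon> \<le> 1" using that N(1) \<epsilon> by (simp add: le_divide_eq) (smt (verit) mult_right_mono of_nat_less_iff)
    then show "t k \<le> 3 / 4" by (simp add: t_def)
  qed
  have BK: "B k \<subseteq> K" if "k < N" for k
  proof
    fix x assume "x \<in> B k"
    then have v: "norm (x - t k *\<^sub>R \<eta>) < \<epsilon> / 8" by (simp add: B_def dist_norm norm_minus_commute)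
    note tk = t[OF that]
    have nt: "\<bar>norm x - t k\<bar> \<le> norm (x - t k *\<^sub>R \<eta>)"
      using norm_triangle_ineq3[of x "t k *\<^sub>R \<eta>"] tk \<eta> by simp
    then have nx: "norm x > 0" "norm x \<le> 1" "norm x \<ge> 1 / 4" using v tk \<epsilon> by linarith+
    have "norm (x /\<^sub>R norm x - \<eta>) * norm x = norm (x - norm x *\<^sub>R \<eta>)"
    proof -
      have "x - norm x *\<^sub>R \<eta> = norm x *\<^sub>R (x /\<^sub>R norm x - \<eta>)" using nx by (simp add: scaleR_diff_right)
      then show ?thesis by (metis abs_norm_cancel mult.commute norm_scaleR)
    qed
    also have "\<dots> \<le> norm (x - t k *\<^sub>R \<eta>) + norm ((t k - norm x) *\<^sub>R \<eta>)"
      using norm_triangle_ineq[of "x - t k *\<^sub>R \<eta>" "(t k - norm x) *\<^sub>R \<eta>"] by (simp add: scaleR_diff_left)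
    also have "\<dots> \<le> \<epsilon> / 8 + \<epsilon> / 8" using nt v \<eta> by (simp add: abs_minus_commute)
    also have "\<dots> \<le> \<epsilon> * norm x" using nx \<epsilon> by (simp add: mult_left_mono)
    finally have "norm (x /\<^sub>R norm x - \<eta>) \<le> \<epsilon>" using nx by simp
    then show "x \<in> K" using nx by (simp add: K_def cap_def)
  qed
  have disj: "disjoint_family_on B {..<N}"
    unfolding disjoint_family_on_def
  proof (intro ballI impI)
    fix i j assume "i \<in> {..<N}" "j \<in> {..<N}" "i \<noteq> j"
    then have "1 \<le> \<bar>real i - real j\<bar>" by linarith
    then have "\<epsilon> / 4 \<le> \<bar>real i - real j\<bar> * (\<epsilon> / 4)" using \<epsilon> by simp
    also have "\<dots> = dist (t i *\<^sub>R \<eta>) (t j *\<^sub>R \<eta>)"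
    proof -
      have "t i *\<^sub>R \<eta> - t j *\<^sub>R \<eta> = ((real i - real j) * (\<epsilon> / 4)) *\<^sub>R \<eta>"
        by (simp add: t_def flip: scaleR_diff_left) (simp add: algebra_simps)
      then show ?thesis using \<eta> \<epsilon> by (simp add: dist_norm abs_mult)
    qed
    finally show "B i \<inter> B j = {}" unfolding B_def by (intro disjoint_ballI) simp
  qed
  have K: "K \<in> sets borel"
  proof -
    have "K = {x. 0 < norm x} \<inter> {x. norm x \<le> 1} \<inter> {x. norm (x /\<^sub>R norm x - \<eta>) \<le> \<epsilon>}"
      by (auto simp: K_def cap_def)
    also have "\<dots> \<in> sets borel" by measurable
    finally show ?thesis .
  qed
  have "bounded K" by (rule bounded_subset[of "cball 0 1"]) (auto simp: K_def)
  then have Kf: "K \<in> fmeasurable lborel"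
    using K emeasure_bounded_finite[of K] by (simp add: fmeasurable_def)
  have finB: "emeasure lborel (B k) \<noteq> \<infinity>" for k
    unfolding B_def using emeasure_lborel_ball_finite[of "t k *\<^sub>R \<eta>" "\<epsilon> / 8"] by (rule less_imp_neq)
  have "real N * (unit_ball_vol (real DIM('a)) * (\<epsilon> / 8) ^ DIM('a)) = (\<Sum>k<N. measure lborel (B k))"
    using \<epsilon> by (simp add: B_def content_ball)
  also have "\<dots> = measure lborel (\<Union>k<N. B k)"
    by (rule measure_finite_Union[symmetric, OF _ _ disj finB]) (auto simp: B_def)
  also have "\<dots> \<le> measure lborel K"
  proof (rule measure_mono_fmeasurable[OF _ _ Kf])
    show "(\<Union>k<N. B k) \<subseteq> K" using BK by auto
    show "(\<Union>k<N. B k) \<in> sets lborel" by (auto simp: B_def)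
  qed
  finally have *: "real N * (unit_ball_vol (real DIM('a)) * (\<epsilon> / 8) ^ DIM('a)) \<le> measure lborel K" .
  have "measure sphere_measure cap = real DIM('a) * measure lborel K"
    unfolding measure_def emeasure_sphere_measure[OF cap] K_def[symmetric] using K by (simp add: enn2real_mult)
  also have "\<dots> \<ge> real DIM('a) * (1 / (2 * \<epsilon>) * (unit_ball_vol (real DIM('a)) * (\<epsilon> / 8) ^ DIM('a)))"
    using N(2) \<epsilon> by (intro mult_left_mono order_trans[OF mult_right_mono *]) auto
  also have "real DIM('a) * (1 / (2 * \<epsilon>) * (unit_ball_vol (real DIM('a)) * (\<epsilon> / 8) ^ DIM('a))) =
     real DIM('a) * unit_ball_vol (real DIM('a)) / (2 * 8 ^ DIM('a)) * \<epsilon> ^ (DIM('a) - 1)"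
    using \<epsilon> power_minus_mult[of "DIM('a)" \<epsilon>] by (simp add: power_divide field_simps)
  finally show ?thesis unfolding cap_def .
qed

section \<open>Estimates for the kernel\<close>

lemma kernel_F_on_sphere:
  fixes x \<eta> :: "'a::euclidean_space"
  assumes "norm x = 1" "norm \<eta> = 1" "\<epsilon> > 0"
  defines "a \<equiv> 1 + \<epsilon>" and "\<delta> \<equiv> 1 - 1 / (1 + \<epsilon>)\<^sup>2"
  shows "kernel_F d m \<epsilon> (x \<bullet> \<eta>) =
         pochhammer (real d / 2) (m - 1) / (2 * fact m) * a ^ (2 * m) * \<delta> ^ (2 * m - 1) *
         norm (x - a *\<^sub>R \<eta>) powi (- int d + 2 - 2 * int m)"
proof -
  have "x \<noteq> a *\<^sub>R \<eta>" using assms by auto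
  then have r: "norm (x - a *\<^sub>R \<eta>) > 0" by simp
  have "(a\<^sup>2 + 1 - 2 * a * (x \<bullet> \<eta>)) powr (- real d / 2 + 1 - real m) =
     norm (x - a *\<^sub>R \<eta>) powr (2 * (- real d / 2 + 1 - real m))"
  proof -
    have "(norm (x - a *\<^sub>R \<eta>))\<^sup>2 = norm (x - a *\<^sub>R \<eta>) powr 2" using r by simp
    then show ?thesis
      unfolding norm_diff_scaleR_sphere[OF assms(1,2), symmetric] by (simp only: powr_powr)
  qed
  also have "2 * (- real d / 2 + 1 - real m) = real_of_int (- int d + 2 - 2 * int m)" by simp
  also have "norm (x - a *\<^sub>R \<eta>) powr \<dots> = norm (x - a *\<^sub>R \<eta>) powi (- int d + 2 - 2 * int m)"
    using r by (simp add: powr_real_of_int' del: of_int_diff of_int_add of_int_minus)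
  finally show ?thesis by (simp add: kernel_F_def a_def \<delta>_def Let_def)
qed

text \<open>The dimensional constant in front of \<open>kernel_F\<close>.\<close>
definition kernel_const :: "nat \<Rightarrow> nat \<Rightarrow> real" where
  "kernel_const d m = pochhammer (real d / 2) (m - 1) / (2 * fact m)"

lemma kernel_const_pos: "d \<ge> 1 \<Longrightarrow> kernel_const d m > 0"
  by (simp add: kernel_const_def pochhammer_pos)

lemma kernel_F_eq_divide:
  fixes x \<eta> :: "'a::euclidean_space"
  assumes "norm x = 1" "norm \<eta> = 1" "\<epsilon> > 0" "d \<ge> 2"
  shows "kernel_F d m \<epsilon> (x \<bullet> \<eta>) = kernel_const d m * (1 + \<epsilon>) ^ (2 * m) * (1 - 1 / (1 + \<epsilon>)\<^sup>2) ^ (2 * m - 1) /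
         norm (x - (1 + \<epsilon>) *\<^sub>R \<eta>) ^ (2 * m + d - 2)"
proof -
  have "- int d + 2 - 2 * int m = - int (2 * m + d - 2)" using assms(4) by simp
  then show ?thesis
    unfolding kernel_F_on_sphere[OF assms(1-3)] kernel_const_def
    by (simp only: power_int_minus power_int_of_nat divide_inverse)
qed

lemma power_divide_power_eq_power_int:
  fixes \<epsilon> :: real
  assumes "\<epsilon> > 0" "d \<ge> 2" "m \<ge> 1"
  shows "\<epsilon> ^ (2 * m - 1) / \<epsilon> ^ (2 * m + d - 2) = \<epsilon> powi (- int d + 1)"
proof -
  have "int (2 * m - 1) - int (2 * m + d - 2) = - int d + 1" using assms by simp
  then show ?thesis using power_int_diff[of \<epsilon> "int (2 * m - 1)" "int (2 * m + d - 2)"] assms(1) by simp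
qed

lemma kernel_F_bounds:
  fixes x \<eta> :: "'a::euclidean_space"
  assumes x: "norm x = 1" and \<eta>: "norm \<eta> = 1" and \<epsilon>: "0 < \<epsilon>" "\<epsilon> \<le> 1" and d: "d \<ge> 2" and m: "m \<ge> 1"
  defines "n \<equiv> 2 * m + d - 2"
  shows kernel_F_pos: "0 < kernel_F d m \<epsilon> (x \<bullet> \<eta>)"
    and kernel_F_le: "kernel_F d m \<epsilon> (x \<bullet> \<eta>) \<le> kernel_const d m * 2 ^ (2 * m) * 2 ^ (2 * m - 1) * 4 ^ n *
       \<epsilon> powi (- int d + 1) / (1 + geodesic_dist x \<eta> / \<epsilon>) ^ n"
    and kernel_F_ge: "norm (x - \<eta>) \<le> \<epsilon> \<Longrightarrow>
      kernel_const d m * (3 / 4) ^ (2 * m - 1) / 2 ^ n * \<epsilon> powi (- int d + 1) \<le> kernel_F d m \<epsilon> (x \<bullet> \<eta>)"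
proof -
  define \<delta> where "\<delta> = 1 - 1 / (1 + \<epsilon>)\<^sup>2"
  define r where "r = norm (x - (1 + \<epsilon>) *\<^sub>R \<eta>)"
  define P where "P = kernel_const d m"
  have P: "P > 0" using d by (simp add: P_def kernel_const_pos)
  have F: "kernel_F d m \<epsilon> (x \<bullet> \<eta>) = P * (1 + \<epsilon>) ^ (2 * m) * \<delta> ^ (2 * m - 1) / r ^ n"
    using kernel_F_eq_divide[OF x \<eta> \<epsilon>(1) d] by (simp add: P_def \<delta>_def r_def n_def)
  have \<delta>: "3 / 4 * \<epsilon> \<le> \<delta>" "\<delta> \<le> 2 * \<epsilon>" using one_minus_inverse_square_bounds[OF \<epsilon>] by (simp_all add: \<delta>_def)
  have \<delta>0: "\<delta> > 0" using \<delta> \<epsilon> by linarith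
  have "x \<noteq> (1 + \<epsilon>) *\<^sub>R \<eta>" using x \<eta> \<epsilon> by auto
  then have r: "r > 0" by (simp add: r_def)
  show "0 < kernel_F d m \<epsilon> (x \<bullet> \<eta>)" unfolding F using P \<delta>0 r \<epsilon> by simp
  define \<rho> where "\<rho> = geodesic_dist x \<eta>"
  have \<rho>: "\<rho> \<ge> 0"
    using Cauchy_Schwarz_ineq2[of x \<eta>] x \<eta> by (simp add: \<rho>_def geodesic_dist_def arccos_lbound abs_le_iff)
  have \<epsilon>n: "\<epsilon> ^ (2 * m - 1) / \<epsilon> ^ n = \<epsilon> powi (- int d + 1)"
    unfolding n_def by (rule power_divide_power_eq_power_int[OF \<epsilon>(1) d m])
  have "P * (1 + \<epsilon>) ^ (2 * m) * \<delta> ^ (2 * m - 1) / r ^ n \<le> P * 2 ^ (2 * m) * (2 * \<epsilon>) ^ (2 * m - 1) / ((\<epsilon> + \<rho>) / 4) ^ n"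
    using P \<delta>0 r \<epsilon> \<delta> \<rho> norm_diff_ge_geodesic[OF x \<eta> \<epsilon>(1)]
    by (intro frac_le mult_mono power_mono mult_nonneg_nonneg zero_less_power) (simp_all add: r_def \<rho>_def)
  also have "\<epsilon> + \<rho> = \<epsilon> * (1 + \<rho> / \<epsilon>)" using \<epsilon> by (simp add: field_simps)
  also have "P * 2 ^ (2 * m) * (2 * \<epsilon>) ^ (2 * m - 1) / (\<epsilon> * (1 + \<rho> / \<epsilon>) / 4) ^ n =
    P * 2 ^ (2 * m) * 2 ^ (2 * m - 1) * 4 ^ n * (\<epsilon> ^ (2 * m - 1) / \<epsilon> ^ n) / (1 + \<rho> / \<epsilon>) ^ n"
    by (simp add: power_mult_distrib power_divide)
  finally show "kernel_F d m \<epsilon> (x \<bullet> \<eta>) \<le> kernel_const d m * 2 ^ (2 * m) * 2 ^ (2 * m - 1) * 4 ^ n *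
       \<epsilon> powi (- int d + 1) / (1 + geodesic_dist x \<eta> / \<epsilon>) ^ n"
    unfolding F \<epsilon>n P_def \<rho>_def .
  assume "norm (x - \<eta>) \<le> \<epsilon>"
  moreover have "r \<le> norm (x - \<eta>) + norm (- (\<epsilon> *\<^sub>R \<eta>))"
    using norm_triangle_ineq[of "x - \<eta>" "- (\<epsilon> *\<^sub>R \<eta>)"] by (simp add: r_def scaleR_add_left diff_diff_eq)
  ultimately have r2: "r \<le> 2 * \<epsilon>" using \<epsilon> \<eta> by simp
  have "P * 1 * (3 / 4 * \<epsilon>) ^ (2 * m - 1) / (2 * \<epsilon>) ^ n \<le> P * (1 + \<epsilon>) ^ (2 * m) * \<delta> ^ (2 * m - 1) / r ^ n"
    using P \<delta>0 r \<epsilon> \<delta> r2 by (intro frac_le mult_mono power_mono mult_nonneg_nonneg zero_less_power one_le_power) simp_all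
  also have "P * 1 * (3 / 4 * \<epsilon>) ^ (2 * m - 1) / (2 * \<epsilon>) ^ n = P * (3 / 4) ^ (2 * m - 1) / 2 ^ n * (\<epsilon> ^ (2 * m - 1) / \<epsilon> ^ n)"
    by (simp only: power_mult_distrib) simp
  finally show "kernel_const d m * (3 / 4) ^ (2 * m - 1) / 2 ^ n * \<epsilon> powi (- int d + 1) \<le> kernel_F d m \<epsilon> (x \<bullet> \<eta>)"
    unfolding F \<epsilon>n P_def .
qed

lemma integrable_kernel_F:
  fixes \<eta> :: "'a::euclidean_space"
  assumes \<eta>: "norm \<eta> = 1" and \<epsilon>: "0 < \<epsilon>" "\<epsilon> \<le> 1" and d: "d \<ge> 2" and m: "m \<ge> 1"
  shows "integrable sphere_measure (\<lambda>x. kernel_F d m \<epsilon> (x \<bullet> \<eta>))"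
proof -
  interpret finite_measure "sphere_measure :: 'a measure" by (rule finite_measure_sphere_measure)
  define B where "B = kernel_const d m * 2 ^ (2 * m) * 2 ^ (2 * m - 1) * 4 ^ (2 * m + d - 2) * \<epsilon> powi (- int d + 1)"
  have B: "B \<ge> 0" using d \<epsilon> kernel_const_pos[of d m] by (simp add: B_def)
  have le: "norm (kernel_F d m \<epsilon> (x \<bullet> \<eta>)) \<le> B" if x: "norm x = 1" for x
  proof -
    have "geodesic_dist x \<eta> \<ge> 0"
      using Cauchy_Schwarz_ineq2[of x \<eta>] x \<eta> by (simp add: geodesic_dist_def arccos_lbound abs_le_iff)
    then have 1: "1 \<le> (1 + geodesic_dist x \<eta> / \<epsilon>) ^ (2 * m + d - 2)" using \<epsilon> by (intro one_le_power) simp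
    have "B / (1 + geodesic_dist x \<eta> / \<epsilon>) ^ (2 * m + d - 2) \<le> B / 1"
      by (rule divide_left_mono) (use 1 B in linarith)+
    moreover have "kernel_F d m \<epsilon> (x \<bullet> \<eta>) \<le> B / (1 + geodesic_dist x \<eta> / \<epsilon>) ^ (2 * m + d - 2)"
      unfolding B_def by (rule kernel_F_le[OF x \<eta> \<epsilon> d m])
    ultimately show ?thesis using kernel_F_pos[OF x \<eta> \<epsilon> d m] by simp
  qed
  have "(\<lambda>x. kernel_F d m \<epsilon> (x \<bullet> \<eta>)) \<in> borel_measurable borel"
    unfolding kernel_F_def Let_def by measurable
  then have "(\<lambda>x. kernel_F d m \<epsilon> (x \<bullet> \<eta>)) \<in> borel_measurable sphere_measure"
    unfolding measurable_cong_sets[OF sets_sphere_measure refl] by (rule measurable_restrict_space1)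
  moreover have "AE x in sphere_measure. norm (kernel_F d m \<epsilon> (x \<bullet> \<eta>)) \<le> B"
    by (rule AE_I2) (rule le, simp)
  ultimately show ?thesis by (intro integrable_const_bound)
qed

text \<open>
The kernel is of size \<open>\<epsilon>\<^sup>1\<^sup>-\<^sup>d\<close> on the cap of radius \<open>\<epsilon>\<close> around \<open>\<eta>\<close>, whose measure is at least
a multiple of \<open>\<epsilon>\<^sup>d\<^sup>-\<^sup>1\<close>; the two powers cancel.
\<close>
lemma integral_kernel_F_ge:
  fixes \<eta> :: "'a::euclidean_space"
  assumes \<eta>: "norm \<eta> = 1" and \<epsilon>: "0 < \<epsilon>" "\<epsilon> \<le> 1" and d: "d \<ge> 2" "DIM('a) = d" and m: "m \<ge> 1"
  shows "kernel_const d m * (3 / 4) ^ (2 * m - 1) / 2 ^ (2 * m + d - 2) *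
      (real d * unit_ball_vol (real d) / (2 * 8 ^ d)) \<le> (\<integral>x. kernel_F d m \<epsilon> (x \<bullet> \<eta>) \<partial>sphere_measure)"
proof -
  interpret finite_measure "sphere_measure :: 'a measure" by (rule finite_measure_sphere_measure)
  define cap where "cap = {x \<in> sphere 0 1. norm (x - \<eta>) \<le> \<epsilon>}"
  define K where "K = kernel_const d m * (3 / 4) ^ (2 * m - 1) / 2 ^ (2 * m + d - 2)"
  have K: "K > 0" using kernel_const_pos[of d m] d by (simp add: K_def)
  have cap: "cap \<in> sets sphere_measure" unfolding cap_def by (rule spherical_cap_measurable)
  have "\<epsilon> powi (- int d + 1) * \<epsilon> ^ (d - 1) = 1"
  proof -
    have "- int d + 1 = - int (d - 1)" using d by simp
    then have "\<epsilon> powi (- int d + 1) = inverse (\<epsilon> ^ (d - 1))"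
      by (simp only: power_int_minus power_int_of_nat)
    then show ?thesis using \<epsilon> by simp
  qed
  then have "K * (real d * unit_ball_vol (real d) / (2 * 8 ^ d)) =
     K * \<epsilon> powi (- int d + 1) * (real d * unit_ball_vol (real d) / (2 * 8 ^ d) * \<epsilon> ^ (d - 1))" by simp
  also have "\<dots> \<le> K * \<epsilon> powi (- int d + 1) * measure sphere_measure cap"
    using measure_spherical_cap_ge[OF \<eta> \<epsilon>] K \<epsilon> unfolding d(2) cap_def
    by (intro mult_left_mono) auto
  also have "\<dots> = (\<integral>x. K * \<epsilon> powi (- int d + 1) * indicator cap x \<partial>sphere_measure)"
    using cap sets.sets_into_space[OF cap] by (simp add: Int_absorb2)
  also have "\<dots> \<le> (\<integral>x. kernel_F d m \<epsilon> (x \<bullet> \<eta>) \<partial>sphere_measure)"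
  proof (rule integral_mono[OF _ integrable_kernel_F[OF \<eta> \<epsilon> d(1) m]])
    show "integrable sphere_measure (\<lambda>x. K * \<epsilon> powi (- int d + 1) * indicator cap x :: real)"
      using cap by (intro integrable_mult_right integrable_real_indicator) (auto simp: less_top[symmetric])
    fix x :: 'a assume "x \<in> space sphere_measure"
    then have x: "norm x = 1" by simp
    show "K * \<epsilon> powi (- int d + 1) * indicator cap x \<le> kernel_F d m \<epsilon> (x \<bullet> \<eta>)"
      using kernel_F_ge[OF x \<eta> \<epsilon> d(1) m] kernel_F_pos[OF x \<eta> \<epsilon> d(1) m]
      by (auto simp: indicator_def cap_def K_def)
  qed
  finally show ?thesis unfolding K_def .
qed

section \<open>Functions with a pole and their directional derivatives\<close>

lemma dir_deriv_eq:
  assumes "(f has_derivative f') (at x)"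
  shows "dir_deriv v f x = f' v"
proof -
  have "((\<lambda>s. f (x + s *\<^sub>R v)) has_derivative (\<lambda>s. f' (s *\<^sub>R v))) (at 0)"
    by (rule has_derivative_compose[of _ "\<lambda>s. s *\<^sub>R v"]) (use assms in \<open>auto intro!: derivative_eq_intros\<close>)
  moreover have "f' (s *\<^sub>R v) = s * f' v" for s
    using has_derivative_bounded_linear[OF assms] by (simp add: linear_cmul bounded_linear.linear)
  ultimately have "((\<lambda>s. f (x + s *\<^sub>R v)) has_field_derivative f' v) (at 0)"
    by (simp add: has_field_derivative_def mult_commute_abs)
  then show ?thesis by (simp add: dir_deriv_def DERIV_imp_deriv)
qed

lemma has_derivative_dir_deriv:
  assumes "f differentiable (at x)"
  shows "(f has_derivative (\<lambda>v. dir_deriv v f x)) (at x)"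
  using assms by (auto simp: differentiable_def dir_deriv_eq)

lemma differentiable_transform_punctured:
  fixes f g :: "'a::euclidean_space \<Rightarrow> real"
  assumes "f differentiable (at x)" "x \<noteq> p" "\<And>x. x \<noteq> p \<Longrightarrow> g x = f x"
  shows "g differentiable (at x)"
  using assms has_derivative_transform_within_open[of f _ x UNIV "- {p}" g]
  by (auto simp: differentiable_def open_Compl)

lemma dir_deriv_cong_punctured:
  fixes f g :: "'a::euclidean_space \<Rightarrow> real"
  assumes "f differentiable (at x)" "x \<noteq> p" "\<And>x. x \<noteq> p \<Longrightarrow> g x = f x"
  shows "dir_deriv v g x = dir_deriv v f x"
  by (rule dir_deriv_eq, rule has_derivative_transform_within_open[OF has_derivative_dir_deriv[OF assms(1)], of "- {p}"])
    (use assms(2,3) in \<open>auto simp: open_Compl\<close>)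

text \<open>
The algebra of functions on the complement of a point \<open>p\<close> that is generated by the constants, the
linear functionals of \<open>x - p\<close>, the integer powers of \<open>|x - p|\<close> and its logarithm. It contains the
fundamental solution with pole \<open>p\<close> in every dimension. The values at \<open>p\<close> are arbitrary, which the
rule \<open>cong\<close> expresses. The point of this class is that it consists of smooth functions and is closed
under directional derivatives, so that all iterates may be formed without further regularity
arguments.
\<close>
inductive pole_fun :: "'a::euclidean_space \<Rightarrow> ('a \<Rightarrow> real) \<Rightarrow> bool" for p where
  const: "pole_fun p (\<lambda>_. c)"
| lin: "pole_fun p (\<lambda>x. (x - p) \<bullet> v)"
| pow: "pole_fun p (\<lambda>x. norm (x - p) powi k)"
| ln: "pole_fun p (\<lambda>x. ln (norm (x - p)))"
| add: "pole_fun p f \<Longrightarrow> pole_fun p g \<Longrightarrow> pole_fun p (\<lambda>x. f x + g x)"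
| mult: "pole_fun p f \<Longrightarrow> pole_fun p g \<Longrightarrow> pole_fun p (\<lambda>x. f x * g x)"
| cong: "pole_fun p f \<Longrightarrow> (\<And>x. x \<noteq> p \<Longrightarrow> g x = f x) \<Longrightarrow> pole_fun p g"

lemma has_derivative_norm_diff:
  fixes x p :: "'a::euclidean_space"
  assumes "x \<noteq> p"
  shows "((\<lambda>x. norm (x - p)) has_derivative (\<lambda>v. ((x - p) \<bullet> v) / norm (x - p))) (at x)"
proof -
  have "((\<lambda>x. x - p) has_derivative (\<lambda>v. v)) (at x)"
    by (auto intro!: derivative_eq_intros)
  then have "((\<lambda>x. norm (x - p)) has_derivative (\<lambda>v. v \<bullet> sgn (x - p))) (at x)"
    by (rule has_derivative_compose) (use assms in \<open>auto intro: has_derivative_norm\<close>)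
  then show ?thesis
    by (simp add: sgn_div_norm inner_commute divide_inverse mult.commute)
qed

lemma has_derivative_norm_powi:
  assumes "x \<noteq> p"
  shows "((\<lambda>x. norm (x - p) powi k) has_derivative
           (\<lambda>v. of_int k * norm (x - p) powi (k - 2) * ((x - p) \<bullet> v))) (at (x::'a::euclidean_space))"
proof -
  have n: "norm (x - p) \<noteq> 0" using assms by simp
  have "((\<lambda>r::real. r powi k) has_field_derivative (of_int k * norm (x - p) powi (k - 1))) (at (norm (x - p)))"
    using DERIV_power_int[of "\<lambda>r. r" 1 "norm (x - p)" UNIV k] n by simp
  then have "((\<lambda>x. norm (x - p) powi k) has_derivative
     (\<lambda>v. (of_int k * norm (x - p) powi (k - 1)) * (((x - p) \<bullet> v) / norm (x - p)))) (at x)"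
    unfolding has_field_derivative_def
    by (rule has_derivative_compose[OF has_derivative_norm_diff[OF assms]])
  moreover have "norm (x - p) powi (k - 1) = norm (x - p) powi (k - 2) * norm (x - p)"
    using n power_int_add[of "norm (x - p)" "k - 2" 1] by simp
  ultimately show ?thesis using n by (simp add: mult.assoc)
qed

lemma has_derivative_ln_norm:
  assumes "x \<noteq> p"
  shows "((\<lambda>x. ln (norm (x - p))) has_derivative
           (\<lambda>v. norm (x - p) powi (-2) * ((x - p) \<bullet> v))) (at (x::'a::euclidean_space))"
proof -
  have n: "norm (x - p) > 0" using assms by simp
  have "(ln has_derivative (\<lambda>h. 1 / norm (x - p) * h)) (at (norm (x - p)))"
    using DERIV_ln_divide[OF n] by (simp only: has_field_derivative_def)
  then have "((\<lambda>x. ln (norm (x - p))) has_derivative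
           (\<lambda>v. 1 / norm (x - p) * (((x - p) \<bullet> v) / norm (x - p)))) (at x)"
    by (rule has_derivative_compose[OF has_derivative_norm_diff[OF assms]])
  moreover have "norm (x - p) powi (-2) = 1 / norm (x - p) * (1 / norm (x - p))"
    by (simp add: power_int_minus power2_eq_square divide_inverse)
  ultimately show ?thesis by simp
qed

lemma pole_fun_differentiable:
  assumes "pole_fun p f" "x \<noteq> p"
  shows "f differentiable (at x)"
  using assms
proof (induction)
  case (cong f g) then show ?case by (blast intro: differentiable_transform_punctured)
next
  case (pow k) then show ?case using has_derivative_norm_powi differentiable_def by blast
next
  case ln then show ?case using has_derivative_ln_norm differentiable_def by blast
qed (auto intro!: derivative_intros)

lemma dir_deriv_const: "dir_deriv v (\<lambda>_. c) x = 0"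
  by (rule dir_deriv_eq) auto

lemma dir_deriv_lin: "dir_deriv v (\<lambda>x. (x - p) \<bullet> w) x = v \<bullet> w"
  by (rule dir_deriv_eq) (auto intro!: derivative_eq_intros)

lemma dir_deriv_norm_powi:
  fixes p :: "'a::euclidean_space"
  shows "x \<noteq> p \<Longrightarrow> dir_deriv v (\<lambda>x. norm (x - p) powi k) x = of_int k * norm (x - p) powi (k - 2) * ((x - p) \<bullet> v)"
  by (rule dir_deriv_eq, rule has_derivative_norm_powi)

lemma dir_deriv_ln_norm:
  fixes p :: "'a::euclidean_space"
  shows "x \<noteq> p \<Longrightarrow> dir_deriv v (\<lambda>x. ln (norm (x - p))) x = norm (x - p) powi (-2) * ((x - p) \<bullet> v)"
  by (rule dir_deriv_eq, rule has_derivative_ln_norm)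

lemma dir_deriv_add:
  assumes "pole_fun p f" "pole_fun p g" "x \<noteq> p"
  shows "dir_deriv v (\<lambda>x. f x + g x) x = dir_deriv v f x + dir_deriv v g x"
  using assms by (intro dir_deriv_eq) (auto intro!: derivative_eq_intros has_derivative_dir_deriv pole_fun_differentiable)

lemma dir_deriv_mult:
  assumes "pole_fun p f" "pole_fun p g" "x \<noteq> p"
  shows "dir_deriv v (\<lambda>x. f x * g x) x = f x * dir_deriv v g x + dir_deriv v f x * g x"
  using assms by (intro dir_deriv_eq) (auto intro!: derivative_eq_intros has_derivative_dir_deriv pole_fun_differentiable)

lemma dir_deriv_cong:
  assumes "pole_fun p f" "x \<noteq> p" "\<And>x. x \<noteq> p \<Longrightarrow> g x = f x"
  shows "dir_deriv v g x = dir_deriv v f x"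
  using assms by (intro dir_deriv_cong_punctured pole_fun_differentiable)

lemma pole_fun_dir_deriv:
  assumes "pole_fun p f"
  shows "pole_fun p (dir_deriv v f)"
  using assms
proof (induction)
  case (const c) show ?case by (rule pole_fun.cong[OF pole_fun.const[of _ 0]]) (simp add: dir_deriv_const)
next
  case (lin w) show ?case by (rule pole_fun.cong[OF pole_fun.const]) (rule dir_deriv_lin)
next
  case (pow k) show ?case
    by (rule pole_fun.cong[OF pole_fun.mult[OF pole_fun.mult[OF pole_fun.const pole_fun.pow] pole_fun.lin]])
      (rule dir_deriv_norm_powi)
next
  case ln show ?case
    by (rule pole_fun.cong[OF pole_fun.mult[OF pole_fun.pow pole_fun.lin]]) (rule dir_deriv_ln_norm)
next
  case (add f g) show ?case
    by (rule pole_fun.cong[OF pole_fun.add[OF add.IH]]) (rule dir_deriv_add[OF add.hyps])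
next
  case (mult f g) show ?case
    by (rule pole_fun.cong[OF pole_fun.add[OF pole_fun.mult[OF mult.hyps(1) mult.IH(2)] pole_fun.mult[OF mult.IH(1) mult.hyps(2)]]])
      (rule dir_deriv_mult[OF mult.hyps])
next
  case (cong f g) show ?case
    by (rule pole_fun.cong[OF cong.IH]) (rule dir_deriv_cong[OF cong.hyps(1) _ cong.hyps(2)])
qed

lemma pole_fun_dir_deriv_funpow: "pole_fun p f \<Longrightarrow> pole_fun p ((dir_deriv v ^^ l) f)"
  by (induction l) (auto intro: pole_fun_dir_deriv)

lemma pole_fun_sum: "(\<And>i. i \<in> I \<Longrightarrow> pole_fun p (f i)) \<Longrightarrow> pole_fun p (\<lambda>x. \<Sum>i\<in>I. f i x)"
  by (induction I rule: infinite_finite_induct) (auto intro: pole_fun.intros)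

lemma dir_deriv_sum:
  assumes "\<And>i. i \<in> I \<Longrightarrow> pole_fun p (f i)" "x \<noteq> p"
  shows "dir_deriv v (\<lambda>x. \<Sum>i\<in>I. f i x) x = (\<Sum>i\<in>I. dir_deriv v (f i) x)"
  using assms by (intro dir_deriv_eq) (auto intro!: derivative_eq_intros has_derivative_dir_deriv pole_fun_differentiable)

lemma dir_deriv_const_mult:
  assumes "pole_fun p f" "x \<noteq> p"
  shows "dir_deriv v (\<lambda>x. c * f x) x = c * dir_deriv v f x"
  using dir_deriv_mult[OF pole_fun.const assms, of v c] by (simp add: dir_deriv_const)

text \<open>
Mixed derivatives agree on the generators by computation; sums and products inherit this by the product
rule.
\<close>
lemma dir_deriv_commute:
  assumes "pole_fun p f" "x \<noteq> p"
  shows "dir_deriv u (dir_deriv v f) x = dir_deriv v (dir_deriv u f) x"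
  using assms
proof (induction arbitrary: x)
  case (const c)
  have "dir_deriv u (dir_deriv v (\<lambda>_. c)) x = 0" for u v :: 'a
    unfolding dir_deriv_cong[OF pole_fun.const[of p 0] const, of "dir_deriv v (\<lambda>_. c)", OF dir_deriv_const]
    by (rule dir_deriv_const)
  then show ?case by simp
next
  case (lin w)
  have "dir_deriv u (dir_deriv v (\<lambda>x. (x - p) \<bullet> w)) x = 0" for u v :: 'a
    unfolding dir_deriv_cong[OF pole_fun.const lin dir_deriv_lin] by (rule dir_deriv_const)
  then show ?case by simp
next
  case (pow k)
  have "dir_deriv u (dir_deriv v (\<lambda>x. norm (x - p) powi k)) x =
     of_int k * norm (x - p) powi (k - 2) * (u \<bullet> v) +
     of_int k * of_int (k - 2) * norm (x - p) powi (k - 4) * ((x - p) \<bullet> u) * ((x - p) \<bullet> v)" for u v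
  proof -
    have "dir_deriv u (dir_deriv v (\<lambda>x. norm (x - p) powi k)) x =
        dir_deriv u (\<lambda>x. of_int k * norm (x - p) powi (k - 2) * ((x - p) \<bullet> v)) x"
      by (rule dir_deriv_cong[OF pole_fun.mult[OF pole_fun.mult[OF pole_fun.const pole_fun.pow] pole_fun.lin] pow])
        (rule dir_deriv_norm_powi)
    also have "\<dots> = of_int k * norm (x - p) powi (k - 2) * (u \<bullet> v) +
        of_int k * (of_int (k - 2) * norm (x - p) powi (k - 2 - 2) * ((x - p) \<bullet> u)) * ((x - p) \<bullet> v)"
      unfolding dir_deriv_mult[OF pole_fun.mult[OF pole_fun.const pole_fun.pow] pole_fun.lin pow]
         dir_deriv_const_mult[OF pole_fun.pow pow] dir_deriv_norm_powi[OF pow] dir_deriv_lin ..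
    finally show ?thesis by (simp add: mult.assoc)
  qed
  then show ?case by (simp add: inner_commute)
next
  case ln
  have "dir_deriv u (dir_deriv v (\<lambda>x. ln (norm (x - p)))) x =
     norm (x - p) powi (-2) * (u \<bullet> v) -
     2 * norm (x - p) powi (-4) * ((x - p) \<bullet> u) * ((x - p) \<bullet> v)" for u v
  proof -
    have "dir_deriv u (dir_deriv v (\<lambda>x. ln (norm (x - p)))) x =
        dir_deriv u (\<lambda>x. norm (x - p) powi (-2) * ((x - p) \<bullet> v)) x"
      by (rule dir_deriv_cong[OF pole_fun.mult[OF pole_fun.pow pole_fun.lin] ln])
        (rule dir_deriv_ln_norm)
    also have "\<dots> = norm (x - p) powi (-2) * (u \<bullet> v) +
        (of_int (-2) * norm (x - p) powi (-2 - 2) * ((x - p) \<bullet> u)) * ((x - p) \<bullet> v)"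
      unfolding dir_deriv_mult[OF pole_fun.pow pole_fun.lin ln] dir_deriv_norm_powi[OF ln] dir_deriv_lin ..
    finally show ?thesis by (simp add: mult.assoc)
  qed
  then show ?case by (simp add: inner_commute)
next
  case (add f g)
  note D = pole_fun_dir_deriv[OF add.hyps(1)] pole_fun_dir_deriv[OF add.hyps(2)]
  have "dir_deriv u (dir_deriv v (\<lambda>x. f x + g x)) x =
    dir_deriv u (dir_deriv v f) x + dir_deriv u (dir_deriv v g) x" for u v
  proof -
    have "dir_deriv u (dir_deriv v (\<lambda>x. f x + g x)) x = dir_deriv u (\<lambda>x. dir_deriv v f x + dir_deriv v g x) x"
      by (rule dir_deriv_cong[OF pole_fun.add[OF D] add.prems]) (rule dir_deriv_add[OF add.hyps])
    then show ?thesis using dir_deriv_add[OF D add.prems] by simp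
  qed
  then show ?case using add by simp
next
  case (mult f g)
  note D = pole_fun_dir_deriv[OF mult.hyps(1)] pole_fun_dir_deriv[OF mult.hyps(2)]
  note M = pole_fun.mult[OF mult.hyps(1) D(2)] pole_fun.mult[OF D(1) mult.hyps(2)]
  have "dir_deriv u (dir_deriv v (\<lambda>x. f x * g x)) x =
    f x * dir_deriv u (dir_deriv v g) x + dir_deriv u f x * dir_deriv v g x
    + dir_deriv v f x * dir_deriv u g x + dir_deriv u (dir_deriv v f) x * g x" for u v
  proof -
    have "dir_deriv u (dir_deriv v (\<lambda>x. f x * g x)) x = dir_deriv u (\<lambda>x. f x * dir_deriv v g x + dir_deriv v f x * g x) x"
      by (rule dir_deriv_cong[OF pole_fun.add[OF M] mult.prems]) (rule dir_deriv_mult[OF mult.hyps])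
    also have "\<dots> = dir_deriv u (\<lambda>x. f x * dir_deriv v g x) x + dir_deriv u (\<lambda>x. dir_deriv v f x * g x) x"
      by (rule dir_deriv_add[OF M mult.prems])
    finally show ?thesis
      using dir_deriv_mult[OF mult.hyps(1) D(2) mult.prems] dir_deriv_mult[OF D(1) mult.hyps(2) mult.prems]
      by simp
  qed
  then show ?case using mult by simp
next
  case (cong f g)
  have "dir_deriv u (dir_deriv v g) x = dir_deriv u (dir_deriv v f) x" for u v
    by (rule dir_deriv_cong[OF pole_fun_dir_deriv[OF cong.hyps(1)] cong.prems])
      (rule dir_deriv_cong[OF cong.hyps(1) _ cong.hyps(2)])
  then show ?case using cong by simp
qed

lemma pole_fun_C2_on:
  assumes "pole_fun p f"
  shows "C2_on f (UNIV - {p})"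
proof -
  have "continuous_on (UNIV - {p}) g" if "pole_fun p g" for g
    using pole_fun_differentiable[OF that]
    by (intro continuous_at_imp_continuous_on ballI differentiable_imp_continuous_within) auto
  then show ?thesis
    unfolding C2_on_def using assms pole_fun_differentiable pole_fun_dir_deriv by blast
qed

lemma laplacian_dir_deriv:
  assumes "pole_fun p f" "x \<noteq> p"
  shows "laplacian (dir_deriv v f) x = dir_deriv v (laplacian f) x"
proof -
  note D = pole_fun_dir_deriv
  have "dir_deriv b (dir_deriv b (dir_deriv v f)) x = dir_deriv v (dir_deriv b (dir_deriv b f)) x" for b
    using dir_deriv_cong[OF D[OF D[OF assms(1)]] assms(2) dir_deriv_commute[OF assms(1)]]
      dir_deriv_commute[OF D[OF assms(1)] assms(2)] by simp
  moreover have "laplacian f = (\<lambda>x. \<Sum>b\<in>Basis. dir_deriv b (dir_deriv b f) x)"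
    by (simp add: laplacian_def fun_eq_iff numeral_2_eq_2)
  ultimately show ?thesis
    by (simp add: laplacian_def numeral_2_eq_2 dir_deriv_sum[OF D[OF D[OF assms(1)]] assms(2)])
qed

lemma harmonic_on_dir_deriv:
  assumes "pole_fun p f" "harmonic_on f (UNIV - {p})"
  shows "harmonic_on (dir_deriv v f) (UNIV - {p})"
proof -
  have "dir_deriv v (laplacian f) x = 0" if "x \<noteq> p" for x
    using dir_deriv_cong[OF pole_fun.const[of p 0] that, of "laplacian f" v] assms(2)
    by (simp add: harmonic_on_def dir_deriv_const)
  then show ?thesis
    using assms pole_fun_C2_on[OF pole_fun_dir_deriv[OF assms(1)]]
    by (auto simp: harmonic_on_def laplacian_dir_deriv)
qed

lemma harmonic_on_dir_deriv_funpow: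
  assumes "pole_fun p f" "harmonic_on f (UNIV - {p})"
  shows "harmonic_on ((dir_deriv v ^^ l) f) (UNIV - {p})"
  using assms by (induction l) (auto intro: harmonic_on_dir_deriv pole_fun_dir_deriv_funpow)

lemma laplacian_add:
  assumes "pole_fun p f" "pole_fun p g" "x \<noteq> p"
  shows "laplacian (\<lambda>x. f x + g x) x = laplacian f x + laplacian g x"
proof -
  note D = pole_fun_dir_deriv
  have "dir_deriv b (dir_deriv b (\<lambda>x. f x + g x)) x =
      dir_deriv b (dir_deriv b f) x + dir_deriv b (dir_deriv b g) x" for b
    using dir_deriv_cong[OF pole_fun.add[OF D D] assms(3) dir_deriv_add, OF assms(1,2) assms(1,2)]
      dir_deriv_add[OF D D assms(3), OF assms(1,2)] by simp
  then show ?thesis by (simp add: laplacian_def numeral_2_eq_2 sum.distrib)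
qed

lemma laplacian_const_mult:
  assumes "pole_fun p f" "x \<noteq> p"
  shows "laplacian (\<lambda>x. c * f x) x = c * laplacian f x"
proof -
  have "dir_deriv b (dir_deriv b (\<lambda>x. c * f x)) x = c * dir_deriv b (dir_deriv b f) x" for b
    using dir_deriv_cong[OF pole_fun.mult[OF pole_fun.const pole_fun_dir_deriv] assms(2) dir_deriv_const_mult, OF assms(1) assms(1)]
      dir_deriv_const_mult[OF pole_fun_dir_deriv[OF assms(1)] assms(2)] by simp
  then show ?thesis by (simp add: laplacian_def numeral_2_eq_2 sum_distrib_left)
qed

lemma harmonic_on_add:
  assumes "pole_fun p f" "pole_fun p g" "harmonic_on f (UNIV - {p})" "harmonic_on g (UNIV - {p})"
  shows "harmonic_on (\<lambda>x. f x + g x) (UNIV - {p})"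
  using assms pole_fun_C2_on[OF pole_fun.add] by (simp add: harmonic_on_def laplacian_add)

lemma harmonic_on_const_mult:
  assumes "pole_fun p f" "harmonic_on f (UNIV - {p})"
  shows "harmonic_on (\<lambda>x. c * f x) (UNIV - {p})"
  using assms pole_fun_C2_on[OF pole_fun.mult[OF pole_fun.const]]
  by (simp add: harmonic_on_def laplacian_const_mult)

lemma harmonic_on_const: "harmonic_on (\<lambda>_. c) (UNIV - {p::'a::euclidean_space})"
proof -
  have "dir_deriv b (\<lambda>_::'a. c) = (\<lambda>_. 0)" for b c by (simp add: fun_eq_iff dir_deriv_const)
  then show ?thesis
    using pole_fun_C2_on[OF pole_fun.const] by (simp add: harmonic_on_def open_Diff laplacian_def numeral_2_eq_2)
qed

lemma harmonic_on_sum: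
  assumes "\<And>i. i \<in> I \<Longrightarrow> pole_fun p (f i)" "\<And>i. i \<in> I \<Longrightarrow> harmonic_on (f i) (UNIV - {p})"
  shows "harmonic_on (\<lambda>x. \<Sum>i\<in>I. f i x) (UNIV - {p})"
  using assms
  by (induction I rule: infinite_finite_induct)
    (auto intro!: harmonic_on_const harmonic_on_add pole_fun_sum)

text \<open>The vector field \<open>(x - p) |x - p|\<^sup>-\<^sup>d\<close> has divergence zero. This form treats \<open>|x - p|\<^sup>2\<^sup>-\<^sup>d\<close> and
  \<open>ln |x - p|\<close> at once.\<close>
lemma harmonic_on_if_gradient:
  fixes p :: "'a::euclidean_space"
  assumes f: "pole_fun p f"
    and grad: "\<And>v x. x \<noteq> p \<Longrightarrow> dir_deriv v f x = c * (norm (x - p) powi (- int DIM('a)) * ((x - p) \<bullet> v))"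
  shows "harmonic_on f (UNIV - {p})"
proof -
  let ?d = "int DIM('a)"
  have "laplacian f x = 0" if x: "x \<noteq> p" for x
  proof -
    have n: "norm (x - p) \<noteq> 0" using x by simp
    have "dir_deriv b (dir_deriv b f) x = c * (norm (x - p) powi (- ?d) * (b \<bullet> b)
        - ?d * norm (x - p) powi (- ?d - 2) * ((x - p) \<bullet> b)\<^sup>2)" for b
    proof -
      have "dir_deriv b (dir_deriv b f) x = dir_deriv b (\<lambda>x. c * (norm (x - p) powi (- ?d) * ((x - p) \<bullet> b))) x"
        by (rule dir_deriv_cong[OF pole_fun.mult[OF pole_fun.const pole_fun.mult[OF pole_fun.pow pole_fun.lin]] x]) (rule grad)
      also have "\<dots> = c * (norm (x - p) powi (- ?d) * (b \<bullet> b) +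
          (of_int (- ?d) * norm (x - p) powi (- ?d - 2) * ((x - p) \<bullet> b)) * ((x - p) \<bullet> b))"
        unfolding dir_deriv_const_mult[OF pole_fun.mult[OF pole_fun.pow pole_fun.lin] x]
          dir_deriv_mult[OF pole_fun.pow pole_fun.lin x] dir_deriv_norm_powi[OF x] dir_deriv_lin ..
      finally show ?thesis by (simp add: power2_eq_square mult.assoc)
    qed
    then have "laplacian f x = (\<Sum>b\<in>Basis. c * (norm (x - p) powi (- ?d)
        - ?d * norm (x - p) powi (- ?d - 2) * ((x - p) \<bullet> b)\<^sup>2))"
      unfolding laplacian_def by (intro sum.cong) (auto simp: numeral_2_eq_2)
    also have "\<dots> = c * (?d * norm (x - p) powi (- ?d)
        - ?d * norm (x - p) powi (- ?d - 2) * (\<Sum>b\<in>Basis. ((x - p) \<bullet> b)\<^sup>2))"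
      by (simp add: sum_subtractf flip: sum_distrib_left)
    also have "(\<Sum>b\<in>Basis. ((x - p) \<bullet> b)\<^sup>2) = (norm (x - p))\<^sup>2"
      unfolding dot_square_norm[symmetric] euclidean_inner[of "x - p" "x - p"] by (simp add: power2_eq_square)
    also have "norm (x - p) powi (- ?d) = norm (x - p) powi (- ?d - 2) * (norm (x - p))\<^sup>2"
      using n power_int_add[of "norm (x - p)" "- ?d - 2" 2] by simp
    finally show ?thesis by simp
  qed
  then show ?thesis using pole_fun_C2_on[OF f] by (simp add: harmonic_on_def open_Diff)
qed

section \<open>The generating power series\<close>

unbundle no vec_syntax
unbundle fps_syntax

text \<open>
The binomial series of \<open>(1 - \<delta> X)\<^sup>-\<^sup>\<mu>\<close>.
\<close>
definition pochhammer_fps :: "real \<Rightarrow> real \<Rightarrow> real fps" where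
  "pochhammer_fps \<delta> \<mu> = Abs_fps (\<lambda>k. pochhammer \<mu> k / fact k * \<delta> ^ k)"

lemma pochhammer_fps_deriv:
  "fps_deriv (pochhammer_fps \<delta> \<mu>) = fps_const (\<mu> * \<delta>) * pochhammer_fps \<delta> (\<mu> + 1)"
  by (simp add: fps_eq_iff pochhammer_fps_def pochhammer_rec divide_simps)

lemma pochhammer_fps_rec:
  "(1 - fps_const \<delta> * fps_X) * pochhammer_fps \<delta> (\<mu> + 1) = pochhammer_fps \<delta> \<mu>"
proof (rule fps_ext)
  fix n
  show "((1 - fps_const \<delta> * fps_X) * pochhammer_fps \<delta> (\<mu> + 1)) $ n = pochhammer_fps \<delta> \<mu> $ n"
  proof (cases n)
    case (Suc k)
    have c: "((1 - fps_const \<delta> * fps_X) * f) $ Suc k = f $ Suc k - \<delta> * f $ k" for f :: "real fps"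
      by (simp add: algebra_simps mult.assoc[of "fps_const \<delta>"])
    have "((1 - fps_const \<delta> * fps_X) * pochhammer_fps \<delta> (\<mu> + 1)) $ Suc k =
        (pochhammer (\<mu> + 1) (Suc k) / fact (Suc k) - pochhammer (\<mu> + 1) k / fact k) * \<delta> ^ Suc k"
      unfolding c unfolding pochhammer_fps_def fps_nth_Abs_fps by (simp add: algebra_simps)
    also have "pochhammer (\<mu> + 1) (Suc k) / fact (Suc k) - pochhammer (\<mu> + 1) k / fact k =
        pochhammer \<mu> (Suc k) / fact (Suc k)"
      unfolding pochhammer_rec'[of "\<mu> + 1"] pochhammer_rec[of \<mu>] fact_Suc
      by (simp add: divide_simps) (simp add: algebra_simps)
    finally show ?thesis unfolding Suc by (simp add: pochhammer_fps_def)
  qed (simp add: pochhammer_fps_def)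
qed

lemma one_minus_X_power_nth: "((1 - fps_X :: real fps) ^ \<nu>) $ i = (-1) ^ i * real (\<nu> choose i)"
proof -
  have "((1 - fps_X :: real fps) ^ \<nu>) = (\<Sum>k\<le>\<nu>. fps_const ((-1) ^ k * real (\<nu> choose k)) * fps_X ^ k)"
    using binomial_ring[of "- fps_X :: real fps" 1 \<nu>]
    by (simp add: power_minus[of fps_X] fps_of_nat mult_ac fps_const_mult[symmetric] fps_const_power[symmetric] flip: fps_const_neg del: fps_const_mult fps_const_power fps_const_neg)
  also have "\<dots> $ i = (-1) ^ i * real (\<nu> choose i)"
    by (simp add: fps_sum_nth fps_X_power_nth if_distrib[of "\<lambda>t. _ * t"] binomial_eq_0 cong: if_cong)
  finally show ?thesis .
qed

text \<open>
The inner sum of the linear system. It is the coefficient of \<open>X\<^sup>l\<close> in the product of \<open>(1 - X)\<^sup>\<nu>\<close> and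
the power of \<open>1 - \<delta> X\<close> with exponent \<open>- (d/2 + \<nu> - 1)\<close>.
\<close>
definition system_coeff :: "nat \<Rightarrow> real \<Rightarrow> nat \<Rightarrow> nat \<Rightarrow> real" where
  "system_coeff d \<delta> \<nu> l = (\<Sum>k=l - \<nu>..l.
              (- 1) ^ (l - k) * real (\<nu> choose (l - k)) *
              pochhammer (real d / 2 + real \<nu> - 1) k * (\<delta> ^ k / fact k))"

lemma system_coeff_eq_fps_nth:
  "system_coeff d \<delta> \<nu> l = ((1 - fps_X) ^ \<nu> * pochhammer_fps \<delta> (real d / 2 + real \<nu> - 1)) $ l"
proof -
  have "((1 - fps_X) ^ \<nu> * pochhammer_fps \<delta> (real d / 2 + real \<nu> - 1)) $ l =
     (\<Sum>k=0..l. (- 1) ^ (l - k) * real (\<nu> choose (l - k)) *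
              pochhammer (real d / 2 + real \<nu> - 1) k * (\<delta> ^ k / fact k))"
    unfolding mult.commute[of "(1 - fps_X) ^ \<nu>"] fps_mult_nth one_minus_X_power_nth
    by (simp add: pochhammer_fps_def mult_ac)
  also have "\<dots> = system_coeff d \<delta> \<nu> l"
    unfolding system_coeff_def by (rule sum.mono_neutral_right) (auto simp: binomial_eq_0)
  finally show ?thesis ..
qed

text \<open>
Let \<open>\<lambda> = d/2 - 1\<close>, \<open>Y = A X (1 - X)\<close> and \<open>Q = 1 - \<delta> X - Y\<close>. For \<open>N \<rightarrow> \<infinity>\<close>, the series below is the expansion
of \<open>(Q\<^sup>-\<^sup>\<lambda> - 1) / (2 \<lambda>)\<close>, respectively of \<open>- ln Q / 2\<close> for \<open>d = 2\<close>, in powers of \<open>Y / (1 - \<delta> X)\<close>: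
the first summand belongs to the power \<open>0\<close>, the \<open>j\<close>-th term of the sum to the power \<open>j\<close>. It is
truncated after the power \<open>N\<close>; since \<open>Y\<close> is divisible by \<open>X\<close>, this does not affect the coefficients of
\<open>X\<^sup>l\<close> with \<open>l \<le> N\<close>. The division by \<open>2 \<lambda>\<close> has been carried out in the coefficients, so that \<open>d = 2\<close>
needs no separate treatment.
\<close>
definition taylor_fps :: "nat \<Rightarrow> real \<Rightarrow> real \<Rightarrow> nat \<Rightarrow> real fps" where
  "taylor_fps d \<delta> A N =
     Abs_fps (\<lambda>l. if l = 0 then 0 else pochhammer (real d / 2) (l - 1) / (2 * fact l) * \<delta> ^ l) +
     (\<Sum>j=1..N. fps_const (pochhammer (real d / 2) (j - 1) / (2 * fact j)) *
       ((fps_const A * (fps_X * (1 - fps_X))) ^ j * pochhammer_fps \<delta> (real d / 2 + real j - 1)))"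

text \<open>
The function \<open>F = (Q\<^sup>-\<^sup>\<lambda> - 1) / (2 \<lambda>)\<close> satisfies \<open>2 Q F' + Q' (2 \<lambda> F + 1) = 0\<close>. The truncated series
satisfies this equation up to an explicit multiple of \<open>Y\<^sup>N\<close>.
\<close>
lemma taylor_fps_ode:
  fixes \<delta> A :: real and d N :: nat
  defines "Y \<equiv> fps_const A * (fps_X * (1 - fps_X)) :: real fps" and "D \<equiv> 1 - fps_const \<delta> * fps_X :: real fps"
  defines "\<mu> \<equiv> real d / 2"
  shows "2 * ((D - Y) * fps_deriv (taylor_fps d \<delta> A N)) + fps_deriv (D - Y) *
      (fps_const (real d - 2) * taylor_fps d \<delta> A N + 1) =
    Y ^ N * fps_const (pochhammer \<mu> N / fact N) * pochhammer_fps \<delta> (\<mu> + N) *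
     (- (D * fps_deriv Y) - fps_const \<delta> * Y)"
proof -
  define p where "p j = fps_const (pochhammer \<mu> j / fact j)" for j
  define b where "b j = fps_const (pochhammer \<mu> (j - 1) / (2 * fact j))" for j
  define g where "g j = pochhammer_fps \<delta> (\<mu> + real j)" for j
  define E where "E = Abs_fps (\<lambda>l. if l = 0 then 0 else pochhammer \<mu> (l - 1) / (2 * fact l) * \<delta> ^ l)"
  define F where "F N = E + (\<Sum>j=1..N. b j * (Y ^ j * g (j - 1)))" for N
  define R where "R N = (\<Sum>j\<le>N. p j * (Y ^ j * g j))" for N
  have F: "taylor_fps d \<delta> A N = F N"
    unfolding taylor_fps_def F_def b_def g_def E_def \<mu>_def Y_def
    by (intro arg_cong2[of _ _ _ _ "(+)"] refl sum.cong) (simp_all add: of_nat_diff algebra_simps)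
  have Dg: "D * g (Suc j) = g j" for j
    using pochhammer_fps_rec[of \<delta> "\<mu> + real j"] by (simp add: D_def g_def add.assoc add.commute[of 1])
  have Dg0: "D * g 0 = 1 + fps_const (2 * (\<mu> - 1)) * E"
  proof -
    have "D * g 0 = pochhammer_fps \<delta> (\<mu> - 1)"
      using pochhammer_fps_rec[of \<delta> "\<mu> - 1"] by (simp add: D_def g_def)
    also have "\<dots> = 1 + fps_const (2 * (\<mu> - 1)) * E"
      by (rule fps_ext) (auto simp: pochhammer_fps_def E_def gr0_conv_Suc pochhammer_rec[of "\<mu> - 1"] divide_simps)
    finally show ?thesis .
  qed
  have E': "2 * fps_deriv E = fps_const \<delta> * g 0"
    by (rule fps_ext) (simp add: E_def g_def pochhammer_fps_def numeral_fps_const divide_simps)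
  have g': "fps_deriv (g j) = fps_const ((\<mu> + real j) * \<delta>) * g (Suc j)" for j
    using pochhammer_fps_deriv[of \<delta> "\<mu> + real j"] by (simp add: g_def add.assoc add.commute[of 1])
  \<comment> \<open>\<open>R N\<close> is the truncation of \<open>Q\<close> to the power \<open>- \<mu>\<close>, expanded in the same way; up to the truncation
    errors, \<open>2 F' = - Q' R\<close> and \<open>Q R = 2 \<lambda> F + 1\<close>.\<close>
  have F': "2 * fps_deriv (F N) = (fps_const \<delta> + fps_deriv Y) * R N - fps_deriv Y * (p N * (Y ^ N * g N))"
  proof (induction N)
    case 0 show ?case using E' by (simp add: F_def R_def p_def algebra_simps)
  next
    case (Suc N)
    have c1: "2 * (b (Suc N) * of_nat (Suc N)) = p N"
      by (rule fps_ext) (simp add: b_def p_def numeral_fps_const fps_of_nat[symmetric] divide_simps del: of_nat_Suc)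
    have c2: "2 * (b (Suc N) * fps_const ((\<mu> + real N) * \<delta>)) = p (Suc N) * fps_const \<delta>"
      by (rule fps_ext) (simp add: b_def p_def numeral_fps_const pochhammer_Suc divide_simps)
    have "2 * fps_deriv (F (Suc N)) = 2 * fps_deriv (F N) +
        2 * (b (Suc N) * fps_deriv (Y ^ Suc N * g N))"
      by (simp add: F_def b_def algebra_simps)
    also have "fps_deriv (Y ^ Suc N * g N) = of_nat (Suc N) * (fps_deriv Y * Y ^ N * g N) +
        fps_const ((\<mu> + real N) * \<delta>) * (Y ^ Suc N * g (Suc N))"
      by (simp only: fps_deriv_mult fps_deriv_power' g' diff_Suc_1 mult_ac add.commute)
    also have "2 * (b (Suc N) * \<dots>) = p N * (fps_deriv Y * Y ^ N * g N) + p (Suc N) * fps_const \<delta> * (Y ^ Suc N * g (Suc N))"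
      unfolding c1[symmetric] c2[symmetric] by (simp only: algebra_simps)
    finally show ?case unfolding Suc.IH by (simp add: R_def algebra_simps)
  qed
  have QR: "(D - Y) * R N = fps_const (2 * (\<mu> - 1)) * F N + 1 - p N * (Y ^ Suc N * g N)"
  proof (induction N)
    case 0 show ?case using Dg0 by (simp add: F_def R_def p_def algebra_simps)
  next
    case (Suc N)
    have c: "p (Suc N) - p N = fps_const (2 * (\<mu> - 1)) * b (Suc N)"
      by (rule fps_ext) (simp add: b_def p_def pochhammer_Suc divide_simps, simp add: algebra_simps)
    have "(D - Y) * R (Suc N) = (D - Y) * R N + p (Suc N) * (Y ^ Suc N * (D * g (Suc N))) - p (Suc N) * (Y ^ Suc (Suc N) * g (Suc N))"
      by (simp add: R_def algebra_simps)
    also have "\<dots> = fps_const (2 * (\<mu> - 1)) * F N + 1 + (p (Suc N) - p N) * (Y ^ Suc N * g N)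
        - p (Suc N) * (Y ^ Suc (Suc N) * g (Suc N))"
      unfolding Suc.IH Dg by (simp add: algebra_simps)
    also have "\<dots> = fps_const (2 * (\<mu> - 1)) * F (Suc N) + 1 - p (Suc N) * (Y ^ Suc (Suc N) * g (Suc N))"
      unfolding c by (simp add: F_def algebra_simps)
    finally show ?case .
  qed
  have D': "fps_deriv (D - Y) = - (fps_const \<delta> + fps_deriv Y)" by (simp add: D_def)
  have mu: "real d - 2 = 2 * (\<mu> - 1)" by (simp add: \<mu>_def)
  have "2 * ((D - Y) * fps_deriv (F N)) = (fps_const \<delta> + fps_deriv Y) * ((D - Y) * R N)
     - (D - Y) * (fps_deriv Y * (p N * (Y ^ N * g N)))"
    using arg_cong[OF F', of "\<lambda>t. (D - Y) * t"] by (simp add: algebra_simps)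
  moreover define cd cm where "cd = fps_const \<delta>" and "cm = fps_const (2 * (\<mu> - 1))"
  ultimately show ?thesis
    unfolding F D' mu QR p_def[symmetric] g_def[symmetric] cd_def[symmetric] cm_def[symmetric]
    by (simp add: algebra_simps)
qed


text \<open>
The differential equation, read off coefficientwise.
\<close>
lemma taylor_fps_rec:
  assumes "l < N"
  shows "2 * real (Suc l) * taylor_fps d \<delta> A N $ Suc l =
    (\<delta> + A) * ((2 * real l + real d - 2) * taylor_fps d \<delta> A N $ l + of_bool (l = 0)) -
    (if l = 0 then 0 else 2 * A * ((real l + real d - 3) * taylor_fps d \<delta> A N $ (l - 1) + of_bool (l = 1)))"
proof -
  define F where "F = taylor_fps d \<delta> A N"
  let ?Y = "fps_const A * (fps_X * (1 - fps_X)) :: real fps"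
  let ?Q = "1 - fps_const \<delta> * fps_X - ?Y"
  let ?G = "fps_const (real d - 2) * F + 1"
  have Q: "(?Q * f) $ l = f $ l - (\<delta> + A) * (if l = 0 then 0 else f $ (l - 1)) + A * (if l \<le> 1 then 0 else f $ (l - 2))" for f l
  proof -
    have "?Q * f = f - fps_const (\<delta> + A) * (fps_X * f) + fps_const A * (fps_X * (fps_X * f))"
      by (simp add: algebra_simps flip: fps_const_add)
    then show ?thesis by (auto simp: numeral_2_eq_2)
  qed
  have Q': "(fps_deriv ?Q * f) $ l = - (\<delta> + A) * f $ l + 2 * A * (if l = 0 then 0 else f $ (l - 1))" for f l
  proof -
    have "fps_deriv ?Q * f = - (fps_const (\<delta> + A) * f) + fps_const (2 * A) * (fps_X * f)"
      by (simp add: algebra_simps numeral_fps_const flip: fps_const_add fps_const_mult)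
    then show ?thesis unfolding \<open>fps_deriv ?Q * f = _\<close> by (simp add: algebra_simps)
  qed
  have "(2 * (?Q * fps_deriv F) + fps_deriv ?Q * ?G) $ l = 0"
  proof -
    have y: "?Y ^ N * f = fps_X ^ N * (fps_const A ^ N * (1 - fps_X) ^ N * f)" for f
      by (simp only: power_mult_distrib mult_ac)
    then show ?thesis
      unfolding F_def taylor_fps_ode mult.assoc y using assms by (simp only: fps_X_power_mult_nth if_True)
  qed
  moreover have "(2 * (?Q * fps_deriv F)) $ l = 2 * (?Q * fps_deriv F) $ l"
    by (simp add: numeral_fps_const)
  ultimately have "2 * (?Q * fps_deriv F) $ l + (fps_deriv ?Q * ?G) $ l = 0" by simp
  then have eq: "2 * (fps_deriv F $ l - (\<delta> + A) * (if l = 0 then 0 else fps_deriv F $ (l - 1)) + A * (if l \<le> 1 then 0 else fps_deriv F $ (l - 2)))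
     + (- (\<delta> + A) * ?G $ l + 2 * A * (if l = 0 then 0 else ?G $ (l - 1))) = 0"
    unfolding Q Q' .
  consider "l = 0" | "l = 1" | k where "l = Suc (Suc k)" by (metis One_nat_def not0_implies_Suc)
  then show ?thesis unfolding F_def[symmetric]
    by cases (use eq in \<open>simp_all add: algebra_simps\<close>)
qed

lemma taylor_fps_unique:
  assumes "c 0 = 0"
    and rec: "\<And>l. l < N \<Longrightarrow> 2 * real (Suc l) * c (Suc l) =
    (\<delta> + A) * ((2 * real l + real d - 2) * c l + of_bool (l = 0)) -
    (if l = 0 then 0 else 2 * A * ((real l + real d - 3) * c (l - 1) + of_bool (l = 1)))"
    and "l \<le> N"
  shows "taylor_fps d \<delta> A N $ l = c l"
  using \<open>l \<le> N\<close>
proof (induction l rule: less_induct)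
  case (less l)
  show ?case
  proof (cases l)
    case 0
    have "(\<Sum>j=1..N. (fps_const (pochhammer (real d / 2) (j - 1) / (2 * fact j)) *
       ((fps_const A * (fps_X * (1 - fps_X))) ^ j * pochhammer_fps \<delta> (real d / 2 + real j - 1))) $ 0) = 0"
      by (rule sum.neutral) (auto simp: power_0_left)
    then show ?thesis using 0 assms(1) by (simp add: taylor_fps_def fps_sum_nth)
  next
    case (Suc k)
    have "taylor_fps d \<delta> A N $ k = c k" "taylor_fps d \<delta> A N $ (k - 1) = c (k - 1)"
      using less Suc by auto
    then have "2 * real (Suc k) * taylor_fps d \<delta> A N $ Suc k = 2 * real (Suc k) * c (Suc k)"
      using taylor_fps_rec[of k N d \<delta> A] rec[of k] less.prems Suc by simp
    then show ?thesis unfolding Suc by simp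
  qed
qed

lemma taylor_fps_nth:
  "taylor_fps d \<delta> A N $ l = (if l = 0 then 0 else pochhammer (real d / 2) (l - 1) / (2 * fact l) * \<delta> ^ l) +
     (\<Sum>j=1..N. pochhammer (real d / 2) (j - 1) / (2 * fact j) * A ^ j * (if l < j then 0 else system_coeff d \<delta> j (l - j)))"
proof -
  have "((fps_const A * (fps_X * (1 - fps_X))) ^ j * pochhammer_fps \<delta> (real d / 2 + real j - 1)) $ l =
      A ^ j * (if l < j then 0 else system_coeff d \<delta> j (l - j))" for j
  proof -
    have "(fps_const A * (fps_X * (1 - fps_X))) ^ j * pochhammer_fps \<delta> (real d / 2 + real j - 1) =
       fps_const (A ^ j) * (fps_X ^ j * ((1 - fps_X) ^ j * pochhammer_fps \<delta> (real d / 2 + real j - 1)))"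
      unfolding fps_const_power[symmetric] by (simp only: power_mult_distrib mult_ac)
    then show ?thesis
      unfolding \<open>(fps_const A * (fps_X * (1 - fps_X))) ^ j * _ = _\<close>
      by (simp add: fps_X_power_mult_nth system_coeff_eq_fps_nth)
  qed
  then show ?thesis by (simp add: taylor_fps_def fps_sum_nth mult.assoc)
qed

lemma coeff_system_alt:
  "coeff_system d m \<delta> q \<longleftrightarrow>
     q 0 + (\<Sum>l=1..m. pochhammer (real d / 2) (l - 1) * (\<delta> ^ (l - 1) / (2 * fact l)) * q l) = 0 \<and>
     (\<forall>\<nu>\<in>{1..m - 1}. (\<Sum>l=0..m - \<nu>. system_coeff d \<delta> \<nu> l * q (\<nu> + l)) = 0) \<and> q m = 1"
  unfolding coeff_system_def system_coeff_def ..

lemma system_coeff_0 [simp]: "system_coeff d \<delta> \<nu> 0 = 1"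
  by (simp add: system_coeff_def)

text \<open>
Summed against the coefficients of the series, a solution of the linear system annihilates every
power of \<open>A\<close> except the \<open>m\<close>-th: the equation with index \<open>\<nu>\<close> says that the contribution of \<open>A\<^sup>\<nu>\<close>
vanishes.
\<close>
lemma coeff_system_sum:
  assumes "coeff_system d m \<delta> q" "\<delta> \<noteq> 0" "m \<ge> 1"
  shows "q 0 + (\<Sum>l=1..m. q l * (taylor_fps d \<delta> A m $ l / \<delta>)) = pochhammer (real d / 2) (m - 1) / (2 * fact m) * A ^ m / \<delta>"
proof -
  define b where "b j = pochhammer (real d / 2) (j - 1) / (2 * fact j) * A ^ j / \<delta>" for j
  have S: "(\<Sum>l=j..m. q l * system_coeff d \<delta> j (l - j)) = of_bool (j = m)" if "j \<in> {1..m}" for j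
  proof (cases "j = m")
    case True then show ?thesis using assms by (simp add: coeff_system_alt)
  next
    case False
    have "(\<Sum>l=j..m. q l * system_coeff d \<delta> j (l - j)) = (\<Sum>l=0..m-j. system_coeff d \<delta> j l * q (j + l))"
      by (rule sum.reindex_bij_witness[of _ "\<lambda>l. j + l" "\<lambda>l. l - j"]) (use that in \<open>auto simp: mult.commute\<close>)
    also have "\<dots> = 0" using assms(1) that False by (auto simp: coeff_system_alt)
    finally show ?thesis using False by simp
  qed
  have "(\<Sum>l=1..m. q l * (taylor_fps d \<delta> A m $ l / \<delta>)) =
     (\<Sum>l=1..m. pochhammer (real d / 2) (l - 1) * (\<delta> ^ (l - 1) / (2 * fact l)) * q l +
        (\<Sum>j=1..m. b j * (if l < j then 0 else q l * system_coeff d \<delta> j (l - j))))"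
  proof (rule sum.cong[OF refl])
    fix l assume l: "l \<in> {1..m}"
    have "q l * (taylor_fps d \<delta> A m $ l / \<delta>) = pochhammer (real d / 2) (l - 1) / (2 * fact l) * (\<delta> ^ l / \<delta>) * q l +
       q l / \<delta> * (\<Sum>j=1..m. pochhammer (real d / 2) (j - 1) / (2 * fact j) * A ^ j * (if l < j then 0 else system_coeff d \<delta> j (l - j)))"
      using l unfolding taylor_fps_nth by (simp add: algebra_simps add_divide_distrib)
    also have "\<delta> ^ l / \<delta> = \<delta> ^ (l - 1)" using l assms(2) by (cases l) auto
    finally show "q l * (taylor_fps d \<delta> A m $ l / \<delta>) = pochhammer (real d / 2) (l - 1) * (\<delta> ^ (l - 1) / (2 * fact l)) * q l +
        (\<Sum>j=1..m. b j * (if l < j then 0 else q l * system_coeff d \<delta> j (l - j)))"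
      by (simp only: sum_distrib_left) (auto simp: b_def mult_ac intro!: sum.cong)
  qed
  also have "\<dots> = - q 0 + (\<Sum>l=1..m. \<Sum>j=1..m. b j * (if l < j then 0 else q l * system_coeff d \<delta> j (l - j)))"
    using assms(1) unfolding sum.distrib coeff_system_alt by simp
  also have "(\<Sum>l=1..m. \<Sum>j=1..m. b j * (if l < j then 0 else q l * system_coeff d \<delta> j (l - j))) =
     (\<Sum>j=1..m. b j * (\<Sum>l=1..m. if l < j then 0 else q l * system_coeff d \<delta> j (l - j)))"
    by (subst sum.swap) (simp add: sum_distrib_left)
  also have "\<dots> = (\<Sum>j=1..m. b j * of_bool (j = m))"
  proof (rule sum.cong[OF refl])
    fix j assume j: "j \<in> {1..m}"
    have "(\<Sum>l=1..m. if l < j then 0 else q l * system_coeff d \<delta> j (l - j)) = (\<Sum>l=j..m. q l * system_coeff d \<delta> j (l - j))"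
      by (rule sum.mono_neutral_cong_right) (use j in auto)
    then show "b j * (\<Sum>l=1..m. if l < j then 0 else q l * system_coeff d \<delta> j (l - j)) = b j * of_bool (j = m)"
      using S[OF j] by simp
  qed
  also have "\<dots> = b m" using assms(3) by (subst sum.remove[of _ m]) auto
  finally show ?thesis by (simp add: b_def)
qed

unbundle no fps_syntax
unbundle vec_syntax

section \<open>Unique solvability of the linear system\<close>

text \<open>
A system in which the equation with index \<open>\<nu>\<close> expresses the unknown \<open>\<nu>\<close> through those with larger
index is solved by backward substitution.
\<close>
lemma triangular_system_unique_solution:
  fixes f :: "nat \<Rightarrow> (nat \<Rightarrow> 'a) \<Rightarrow> 'a"
  assumes dep: "\<And>\<nu> p q. \<nu> \<le> m \<Longrightarrow> (\<And>i. \<nu> < i \<Longrightarrow> i \<le> m \<Longrightarrow> p i = q i) \<Longrightarrow> f \<nu> p = f \<nu> q"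
  shows "\<exists>!q. q \<in> extensional {0..m} \<and> (\<forall>\<nu>\<le>m. q \<nu> = f \<nu> q)"
proof -
  \<comment> \<open>The last \<open>k\<close> equations are solved by induction on \<open>k\<close>.\<close>
  have "\<exists>q. \<forall>\<nu>\<le>m. m < \<nu> + k \<longrightarrow> q \<nu> = f \<nu> q" for k
  proof (induction k)
    case (Suc k)
    then obtain q where q: "\<And>\<nu>. \<nu> \<le> m \<Longrightarrow> m < \<nu> + k \<Longrightarrow> q \<nu> = f \<nu> q" by blast
    define q' where "q' = q(m - k := f (m - k) q)"
    have "q' \<nu> = f \<nu> q'" if "\<nu> \<le> m" "m < \<nu> + Suc k" for \<nu>
    proof (cases "k \<le> m \<and> \<nu> = m - k")
      case True
      then have "f \<nu> q' = f \<nu> q" by (intro dep) (auto simp: q'_def)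
      then show ?thesis using True by (simp add: q'_def)
    next
      case False
      show ?thesis
      proof (cases "k \<le> m")
        case True
        then have "f \<nu> q' = f \<nu> q" using that False by (intro dep) (auto simp: q'_def)
        moreover have "q' \<nu> = q \<nu>" using False True by (simp add: q'_def)
        ultimately show ?thesis using q[of \<nu>] that False True by simp
      next
        case False
        then have *: "q \<nu> = f \<nu> q" if "\<nu> \<le> m" for \<nu> using q that by simp
        have "q' = q" using *[of 0] False by (auto simp: q'_def fun_eq_iff)
        then show ?thesis using * that by simp
      qed
    qed
    then show ?case by blast
  qed simp
  from this[of "Suc m"] obtain q where q: "\<And>\<nu>. \<nu> \<le> m \<Longrightarrow> q \<nu> = f \<nu> q" by auto
  show ?thesis
  proof (rule ex1I[of _ "restrict q {0..m}"])
    have "f \<nu> (restrict q {0..m}) = f \<nu> q" if "\<nu> \<le> m" for \<nu> using that by (intro dep) auto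
    then show "restrict q {0..m} \<in> extensional {0..m} \<and> (\<forall>\<nu>\<le>m. restrict q {0..m} \<nu> = f \<nu> (restrict q {0..m}))"
      using q by auto
  next
    fix p assume p: "p \<in> extensional {0..m} \<and> (\<forall>\<nu>\<le>m. p \<nu> = f \<nu> p)"
    have "p \<nu> = q \<nu>" if "\<nu> \<le> m" for \<nu>
      using that
    proof (induction "m - \<nu>" arbitrary: \<nu> rule: less_induct)
      case less
      have "f \<nu> p = f \<nu> q" using less by (intro dep) auto
      then show ?case using p q less.prems by simp
    qed
    then show "p = restrict q {0..m}" using p by (auto simp: fun_eq_iff extensional_def)
  qed
qed

lemma coeff_system_unique_solution:
  assumes "m \<ge> 1"
  shows "\<exists>!q. q \<in> extensional {0..m} \<and> coeff_system d m \<delta> q"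
proof -
  define f where "f \<nu> q = (if \<nu> = m then 1 else if \<nu> = 0
      then - (\<Sum>l=1..m. pochhammer (real d / 2) (l - 1) * (\<delta> ^ (l - 1) / (2 * fact l)) * q l)
      else - (\<Sum>l=1..m - \<nu>. system_coeff d \<delta> \<nu> l * q (\<nu> + l)))" for \<nu> and q :: "nat \<Rightarrow> real"
  have "\<exists>!q. q \<in> extensional {0..m} \<and> (\<forall>\<nu>\<le>m. q \<nu> = f \<nu> q)"
  proof (rule triangular_system_unique_solution)
    fix \<nu> and p q :: "nat \<Rightarrow> real" assume "\<nu> \<le> m" and pq: "\<And>i. \<nu> < i \<Longrightarrow> i \<le> m \<Longrightarrow> p i = q i"
    then show "f \<nu> p = f \<nu> q"
      unfolding f_def by (auto intro!: sum.cong)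
  qed
  moreover have "coeff_system d m \<delta> q \<longleftrightarrow> (\<forall>\<nu>\<le>m. q \<nu> = f \<nu> q)" for q
  proof -
    have "(\<Sum>l=0..m - \<nu>. system_coeff d \<delta> \<nu> l * q (\<nu> + l)) = q \<nu> + (\<Sum>l=1..m - \<nu>. system_coeff d \<delta> \<nu> l * q (\<nu> + l))" for \<nu>
      by (simp add: sum.atLeast_Suc_atMost)
    moreover have "(\<forall>\<nu>\<le>m. P \<nu>) \<longleftrightarrow> P 0 \<and> (\<forall>\<nu>\<in>{1..m - 1}. P \<nu>) \<and> P m" for P
    proof -
      have "{..m} = insert 0 (insert m {1..m - 1})" using assms by auto
      then show ?thesis by (metis (no_types) atMost_iff insert_iff)
    qed
    ultimately show ?thesis
      using assms unfolding coeff_system_alt by (simp add: f_def eq_neg_iff_add_eq_0) (use assms in auto)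
  qed
  ultimately show ?thesis by simp
qed

section \<open>Taylor coefficients of the fundamental solution\<close>

text \<open>
Let \<open>f\<close> have derivative \<open>- \<theta> |x - p|\<^sup>-\<^sup>d (x - p) \<bullet> \<eta>\<close> in direction \<open>\<eta>\<close>. Multiplying by \<open>|x - p|\<^sup>2\<close> and
differentiating repeatedly in direction \<open>\<eta>\<close> gives a three-term recurrence for the iterated derivatives.
At its start, the place of \<open>f\<close> itself is taken by a multiple of \<open>|x - p|\<^sup>2\<^sup>-\<^sup>d\<close>, which is constant for
\<open>d = 2\<close>.
\<close>
lemma dir_deriv_iterates_rec:
  fixes p \<eta> :: "'a::euclidean_space" and d :: nat
  assumes f: "pole_fun p f" and \<eta>: "norm \<eta> = 1"
    and grad: "\<And>x. x \<noteq> p \<Longrightarrow> dir_deriv \<eta> f x = - \<theta> * (norm (x - p) powi (- int d) * ((x - p) \<bullet> \<eta>))"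
    and x: "x \<noteq> p"
  shows "(norm (x - p))\<^sup>2 * (dir_deriv \<eta> ^^ (l + 2)) f x
    + (2 * real l + real d) * ((x - p) \<bullet> \<eta>) * (dir_deriv \<eta> ^^ (l + 1)) f x
    + (if l = 0 then \<theta> * norm (x - p) powi (2 - int d)
       else real (l + 1) * (real l + real d - 2) * (dir_deriv \<eta> ^^ l) f x) = 0"
  using x
proof (induction l arbitrary: x)
  case 0
  define E where "E l = (dir_deriv \<eta> ^^ l) f" for l
  have E: "pole_fun p (E l)" for l unfolding E_def by (rule pole_fun_dir_deriv_funpow[OF f])
  have ES: "dir_deriv \<eta> (E l) = E (Suc l)" for l by (simp add: E_def)
  have pw: "norm (x - p) powi (2 - int d) = norm (x - p) powi (- int d) * (norm (x - p))\<^sup>2" if "x \<noteq> p" for x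
    using that power_int_add[of "norm (x - p)" "- int d" 2] by simp
  have e1: "norm (x - p) powi 2 * E 1 x = - \<theta> * (norm (x - p) powi (2 - int d) * ((x - p) \<bullet> \<eta>))" if "x \<noteq> p" for x
    using grad[OF that] pw[OF that] by (simp add: E_def)
  have "dir_deriv \<eta> (\<lambda>x. norm (x - p) powi 2 * E 1 x) x =
     dir_deriv \<eta> (\<lambda>x. - \<theta> * (norm (x - p) powi (2 - int d) * ((x - p) \<bullet> \<eta>))) x"
    by (rule dir_deriv_cong[OF pole_fun.mult[OF pole_fun.const pole_fun.mult[OF pole_fun.pow pole_fun.lin]] 0]) (rule e1)
  then have "norm (x - p) powi 2 * E 2 x + of_int 2 * norm (x - p) powi (2 - 2) * ((x - p) \<bullet> \<eta>) * E 1 x =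
     - \<theta> * (norm (x - p) powi (2 - int d) * (\<eta> \<bullet> \<eta>) + of_int (2 - int d) * norm (x - p) powi (2 - int d - 2) * ((x - p) \<bullet> \<eta>) * ((x - p) \<bullet> \<eta>))"
    unfolding dir_deriv_const_mult[OF pole_fun.mult[OF pole_fun.pow pole_fun.lin] 0]
      dir_deriv_mult[OF pole_fun.pow pole_fun.lin 0] dir_deriv_mult[OF pole_fun.pow E 0]
      dir_deriv_norm_powi[OF 0] dir_deriv_lin ES by (simp add: numeral_2_eq_2)
  moreover have "E 1 x = - \<theta> * (norm (x - p) powi (- int d) * ((x - p) \<bullet> \<eta>))" using grad[OF 0] by (simp add: E_def)
  moreover have "\<eta> \<bullet> \<eta> = 1" using \<eta> by (simp add: dot_square_norm)
  moreover define s where "s = (x - p) \<bullet> \<eta>"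
  ultimately have "(norm (x - p))\<^sup>2 * E 2 x + real d * s * E 1 x + \<theta> * norm (x - p) powi (2 - int d) = 0"
    unfolding s_def[symmetric] by (simp add: algebra_simps)
  then show ?case by (simp add: E_def s_def numeral_2_eq_2)
next
  case (Suc l)
  define E where "E l = (dir_deriv \<eta> ^^ l) f" for l
  have E: "pole_fun p (E l)" for l unfolding E_def by (rule pole_fun_dir_deriv_funpow[OF f])
  have ES: "dir_deriv \<eta> (E l) = E (Suc l)" for l by (simp add: E_def)
  define g where "g = (\<lambda>x. if l = 0 then \<theta> * norm (x - p) powi (2 - int d)
       else real (l + 1) * (real l + real d - 2) * E l x)"
  have g: "pole_fun p g" unfolding g_def by (cases "l = 0") (simp_all add: pole_fun.mult[OF pole_fun.const] pole_fun.pow E)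
  note P1 = pole_fun.mult[OF pole_fun.pow[of p 2] E[of "l + 2"]]
  note P2 = pole_fun.mult[OF pole_fun.lin[of p \<eta>] E[of "l + 1"]]
  note P2' = pole_fun.mult[OF pole_fun.const[of p "2 * real l + real d"] P2]
  have "norm (x - p) powi 2 * E (l + 2) x + (2 * real l + real d) * (((x - p) \<bullet> \<eta>) * E (l + 1) x) + g x = 0"
    if "x \<noteq> p" for x
    using Suc.IH[OF that] by (cases "l = 0") (simp_all add: E_def g_def mult.assoc)
  then have "dir_deriv \<eta> (\<lambda>x. norm (x - p) powi 2 * E (l + 2) x + (2 * real l + real d) * (((x - p) \<bullet> \<eta>) * E (l + 1) x) + g x) x
    = dir_deriv \<eta> (\<lambda>_. 0) x"
    by (rule dir_deriv_cong[OF pole_fun.const Suc.prems])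
  then have "norm (x - p) powi 2 * E (l + 3) x + of_int 2 * norm (x - p) powi (2 - 2) * ((x - p) \<bullet> \<eta>) * E (l + 2) x
    + (2 * real l + real d) * (((x - p) \<bullet> \<eta>) * E (l + 2) x + (\<eta> \<bullet> \<eta>) * E (l + 1) x) + dir_deriv \<eta> g x = 0"
    unfolding dir_deriv_add[OF pole_fun.add[OF P1 P2'] g Suc.prems] dir_deriv_add[OF P1 P2' Suc.prems]
      dir_deriv_const_mult[OF P2 Suc.prems] dir_deriv_mult[OF pole_fun.lin E Suc.prems]
      dir_deriv_mult[OF pole_fun.pow E Suc.prems] dir_deriv_norm_powi[OF Suc.prems] dir_deriv_lin ES dir_deriv_const
    by (simp add: eval_nat_numeral)
  moreover have "dir_deriv \<eta> g x = (if l = 0 then real d - 2 else real (l + 1) * (real l + real d - 2)) * E (l + 1) x"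
  proof (cases "l = 0")
    case True
    have "dir_deriv \<eta> g x = \<theta> * (of_int (2 - int d) * norm (x - p) powi (2 - int d - 2) * ((x - p) \<bullet> \<eta>))"
      unfolding g_def using True
      by (simp add: dir_deriv_const_mult[OF pole_fun.pow Suc.prems] dir_deriv_norm_powi[OF Suc.prems])
    also have "\<dots> = (real d - 2) * E 1 x"
    proof -
      have E1: "E 1 x = - \<theta> * (norm (x - p) powi (- int d) * ((x - p) \<bullet> \<eta>))"
        using grad[OF Suc.prems] by (simp add: E_def)
      show ?thesis unfolding E1 by (simp add: algebra_simps)
    qed
    finally show ?thesis using True by simp
  next
    case False
    then show ?thesis unfolding g_def by (simp add: dir_deriv_const_mult[OF E Suc.prems] ES)
  qed
  moreover have "\<eta> \<bullet> \<eta> = 1" using \<eta> by (simp add: dot_square_norm)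
  moreover define s where "s = (x - p) \<bullet> \<eta>"
  ultimately have "(norm (x - p))\<^sup>2 * E (l + 3) x + 2 * s * E (l + 2) x
    + (2 * real l + real d) * (s * E (l + 2) x + E (l + 1) x)
    + (if l = 0 then real d - 2 else real (l + 1) * (real l + real d - 2)) * E (l + 1) x = 0"
    unfolding s_def[symmetric] using Suc.prems by simp
  then have "(norm (x - p))\<^sup>2 * E (l + 3) x + (2 * real (Suc l) + real d) * s * E (l + 2) x
    + real (Suc l + 1) * (real (Suc l) + real d - 2) * E (l + 1) x = 0"
    by (cases "l = 0") (simp_all add: algebra_simps)
  moreover have e: "l + 3 = Suc l + 2" "l + 2 = Suc l + 1" "l + 1 = Suc l" by simp_all
  ultimately have "(norm (x - p))\<^sup>2 * E (Suc l + 2) x + (2 * real (Suc l) + real d) * s * E (Suc l + 1) x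
    + real (Suc l + 1) * (real (Suc l) + real d - 2) * E (Suc l) x = 0"
    by (simp only: e)
  then show ?case by (simp only: E_def s_def if_False nat.distinct)
qed

text \<open>
On the unit sphere \<open>2 a (x - a \<eta>) \<bullet> \<eta> = - (a\<^sup>2 \<delta> + |x - a \<eta>|\<^sup>2)\<close>, which eliminates the inner product from
the recurrence of the derivatives. What remains is the recurrence of the coefficients of \<open>taylor_fps\<close>.
\<close>
lemma dir_deriv_iterates_eq_taylor_fps:
  fixes x \<eta> :: "'a::euclidean_space" and d :: nat
  assumes f: "pole_fun (a *\<^sub>R \<eta>) f" and \<eta>: "norm \<eta> = 1" and x: "norm x = 1" and a: "a > 1"
    and \<theta>: "\<theta> \<noteq> 0"
    and grad: "\<And>x. x \<noteq> a *\<^sub>R \<eta> \<Longrightarrow> dir_deriv \<eta> f x = - \<theta> * (norm (x - a *\<^sub>R \<eta>) powi (- int d) * ((x - a *\<^sub>R \<eta>) \<bullet> \<eta>))"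
    and l: "1 \<le> l" "l \<le> N"
  defines "\<delta> \<equiv> 1 - 1 / a\<^sup>2" and "r \<equiv> norm (x - a *\<^sub>R \<eta>)"
  shows "a ^ l * \<delta> ^ l / fact l * (dir_deriv \<eta> ^^ l) f x =
     \<theta> * r powi (2 - int d) * fps_nth (taylor_fps d \<delta> (a\<^sup>2 * \<delta>\<^sup>2 / r\<^sup>2) N) l"
proof -
  have ne: "x \<noteq> a *\<^sub>R \<eta>" using \<eta> x a by auto
  then have r: "r \<noteq> 0" by (simp add: r_def)
  define s where "s = (x - a *\<^sub>R \<eta>) \<bullet> \<eta>"
  have r2: "r\<^sup>2 = 1 + a\<^sup>2 - 2 * a * (x \<bullet> \<eta>)"
    using norm_diff_scaleR_sphere[OF x \<eta>, of a] by (simp add: r_def)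
  have s: "2 * (a * s) = - (a\<^sup>2 * \<delta> + r\<^sup>2)"
    using \<eta> a unfolding r2 s_def \<delta>_def by (simp add: inner_diff_left dot_square_norm power2_eq_square algebra_simps)
  define A where "A = a\<^sup>2 * \<delta>\<^sup>2 / r\<^sup>2"
  define \<kappa> where "\<kappa> = \<theta> * r powi (2 - int d)"
  have \<kappa>: "\<kappa> \<noteq> 0" using \<theta> r by (simp add: \<kappa>_def)
  define E where "E l = (dir_deriv \<eta> ^^ l) f x" for l
  \<comment> \<open>Taylor coefficients in the variable \<open>w\<close>, where \<open>h = a \<delta> w\<close>, normalised to leading factor \<open>1\<close>; the
    value at \<open>0\<close> is set to \<open>0\<close> to match the series.\<close>
  define c where "c l = (if l = 0 then 0 else a ^ l * \<delta> ^ l / fact l * E l / \<kappa>)" for l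
  have Ar: "A * r\<^sup>2 = a\<^sup>2 * \<delta>\<^sup>2" using r by (simp add: A_def)
  have "2 * a * \<delta> * s = \<delta> * (2 * (a * s))" by simp
  also have "\<dots> = - (\<delta> * r\<^sup>2 + A * r\<^sup>2)" unfolding s Ar by (simp add: power2_eq_square algebra_simps)
  finally have sr: "2 * a * \<delta> * s = - (\<delta> + A) * r\<^sup>2" by (simp add: algebra_simps)
  have "fps_nth (taylor_fps d \<delta> A N) l = c l"
  proof (rule taylor_fps_unique[OF _ _ l(2)])
    show "c 0 = 0" by (simp add: c_def)
    fix k
    show "2 * real (Suc k) * c (Suc k) =
      (\<delta> + A) * ((2 * real k + real d - 2) * c k + of_bool (k = 0)) -
      (if k = 0 then 0 else 2 * A * ((real k + real d - 3) * c (k - 1) + of_bool (k = 1)))"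
    proof (cases k)
      case 0
      have "r powi (2 - int d) = r powi (- int d) * r\<^sup>2"
        using r power_int_add[of r "- int d" 2] by simp
      then have "E 1 * r\<^sup>2 = - \<kappa> * s"
        using grad[OF ne] by (simp add: E_def \<kappa>_def r_def[symmetric] s_def[symmetric])
      then have "2 * a * \<delta> * E 1 * r\<^sup>2 = - \<kappa> * (2 * a * \<delta> * s)" by simp
      also have "\<dots> = \<kappa> * (\<delta> + A) * r\<^sup>2" unfolding sr by (simp add: algebra_simps)
      finally have "2 * a * \<delta> * E 1 = \<kappa> * (\<delta> + A)" using r by simp
      then show ?thesis using 0 \<kappa> by (simp add: c_def field_simps)
    next
      case (Suc j)
      have "r\<^sup>2 * E (j + 2) + (2 * real j + real d) * s * E (j + 1)
        + (if j = 0 then \<kappa> else real (j + 1) * (real j + real d - 2) * E j) = 0"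
        unfolding E_def \<kappa>_def r_def s_def by (rule dir_deriv_iterates_rec[OF f \<eta> grad ne])
      then have "0 = 2 * a ^ (j + 2) * \<delta> ^ (j + 2) * (r\<^sup>2 * E (j + 2) + (2 * real j + real d) * s * E (j + 1)
        + (if j = 0 then \<kappa> else real (j + 1) * (real j + real d - 2) * E j))" by simp
      also have "\<dots> = 2 * a ^ (j + 2) * \<delta> ^ (j + 2) * r\<^sup>2 * E (j + 2) + (2 * real j + real d) * (a ^ (j + 1) * \<delta> ^ (j + 1)) * (2 * a * \<delta> * s) * E (j + 1)
        + 2 * (a\<^sup>2 * \<delta>\<^sup>2) * (a ^ j * \<delta> ^ j) * (if j = 0 then \<kappa> else real (j + 1) * (real j + real d - 2) * E j)"
        by (simp add: algebra_simps power2_eq_square)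
      also have "\<dots> = r\<^sup>2 * (2 * a ^ (j + 2) * \<delta> ^ (j + 2) * E (j + 2) - (\<delta> + A) * (2 * real j + real d) * (a ^ (j + 1) * \<delta> ^ (j + 1)) * E (j + 1)
        + 2 * A * (a ^ j * \<delta> ^ j) * (if j = 0 then \<kappa> else real (j + 1) * (real j + real d - 2) * E j))"
        unfolding sr Ar[symmetric] by (simp add: algebra_simps)
      finally have *: "2 * (a ^ (j + 2) * \<delta> ^ (j + 2) * E (j + 2)) = (\<delta> + A) * (2 * real j + real d) * (a ^ (j + 1) * \<delta> ^ (j + 1) * E (j + 1))
        - 2 * A * (if j = 0 then \<kappa> else real (j + 1) * (real j + real d - 2) * (a ^ j * \<delta> ^ j * E j))"
        using r by (simp add: mult_ac split: if_splits)
      have e: "a ^ k * \<delta> ^ k * E k = \<kappa> * fact k * c k" if "k \<noteq> 0" for k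
        using that \<kappa> by (simp add: c_def)
      have e': "(if j = 0 then \<kappa> else real (j + 1) * (real j + real d - 2) * (a ^ j * \<delta> ^ j * E j)) =
         \<kappa> * fact (j + 1) * (of_bool (j = 0) + (real j + real d - 2) * c j)"
        using e[of j] by (cases "j = 0") (simp_all add: c_def)
      have "2 * (\<kappa> * fact (j + 2) * c (j + 2)) = (\<delta> + A) * (2 * real j + real d) * (\<kappa> * fact (j + 1) * c (j + 1))
         - 2 * A * (\<kappa> * fact (j + 1) * (of_bool (j = 0) + (real j + real d - 2) * c j))"
        using *[unfolded e'] e[of "j + 2"] e[of "j + 1"] by simp
      moreover have "(fact (j + 2) :: real) = fact (j + 1) * real (j + 2)"
        by (simp add: algebra_simps)
      ultimately have "(\<kappa> * fact (j + 1)) * (2 * real (j + 2) * c (j + 2)) =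
         (\<kappa> * fact (j + 1)) * ((\<delta> + A) * (2 * real j + real d) * c (j + 1)
         - 2 * A * (of_bool (j = 0) + (real j + real d - 2) * c j))"
        by (simp only: right_diff_distrib mult_ac)
      then have "2 * real (j + 2) * c (j + 2) = (\<delta> + A) * (2 * real j + real d) * c (j + 1)
         - 2 * A * (of_bool (j = 0) + (real j + real d - 2) * c j)"
        using \<kappa> by (simp del: fact_Suc)
      then show ?thesis unfolding Suc by (simp add: algebra_simps)
    qed
  qed
  then show ?thesis
    unfolding \<kappa>_def[symmetric] A_def[symmetric] using l \<kappa> by (simp add: c_def E_def)
qed

section \<open>The harmonic extension\<close>

lemma
  fixes \<eta> :: "'a::euclidean_space" and d m :: nat
  assumes d: "d \<ge> 2" "DIM('a) = d" and \<eta>: "norm \<eta> = 1" and \<epsilon>: "\<epsilon> > 0"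
    and q: "coeff_system d m (1 - 1 / (1 + \<epsilon>)\<^sup>2) q" and m: "m \<ge> 1"
  shows harmonic_on_harmonic_H: "harmonic_on (harmonic_H d m \<epsilon> q \<eta>) (UNIV - {(1 + \<epsilon>) *\<^sub>R \<eta>})"
    and harmonic_H_on_sphere: "norm x = 1 \<Longrightarrow> harmonic_H d m \<epsilon> q \<eta> x = kernel_F d m \<epsilon> (x \<bullet> \<eta>)"
proof -
  define a where "a = 1 + \<epsilon>"
  define \<delta> where "\<delta> = 1 - 1 / a\<^sup>2"
  define p where "p = a *\<^sub>R \<eta>"
  define \<Phi> where "\<Phi> = (if d = 2 then (\<lambda>y. ln (1 / norm (y - p))) else (\<lambda>y. norm (y - p) powi (2 - int d)))"
  define \<theta> where "\<theta> = (if d = 2 then 1 else real d - 2)"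
  define C where "C l = q l * \<delta> ^ (l - 1) * a ^ l / fact l / \<theta>" for l
  have a: "a > 1" using \<epsilon> by (simp add: a_def)
  have \<delta>: "\<delta> \<noteq> 0" using one_less_power[OF a, of 2] by (simp add: \<delta>_def)
  have \<theta>: "\<theta> \<noteq> 0" using d(1) by (simp add: \<theta>_def)
  have H: "harmonic_H d m \<epsilon> q \<eta> = (\<lambda>x. q 0 * norm (x - p) powi (2 - int d) + (\<Sum>l=1..m. C l * (dir_deriv \<eta> ^^ l) \<Phi> x))"
    by (rule ext) (simp add: harmonic_H_def Let_def C_def \<Phi>_def \<theta>_def a_def \<delta>_def p_def)
  have ln: "ln (1 / norm (y - p)) = - 1 * ln (norm (y - p))" for y :: 'a
    by (cases "y = p") (simp_all add: ln_div)
  \<comment> \<open>With \<open>\<theta>\<close> as above, the gradient takes the same form in every dimension \<open>d \<ge> 2\<close>.\<close>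
  have \<Phi>: "pole_fun p \<Phi>"
    unfolding \<Phi>_def ln
    using pole_fun.mult[OF pole_fun.const pole_fun.ln, of p "- 1"] pole_fun.pow[of p "2 - int d"]
    by (cases "d = 2") simp_all
  have grad: "dir_deriv v \<Phi> x = - \<theta> * (norm (x - p) powi (- int d) * ((x - p) \<bullet> v))" if "x \<noteq> p" for x v
  proof (cases "d = 2")
    case True
    then have "dir_deriv v \<Phi> x = dir_deriv v (\<lambda>x. - 1 * ln (norm (x - p))) x"
      unfolding \<Phi>_def ln by (simp only: if_True simp_thms)
    also have "\<dots> = - 1 * (norm (x - p) powi (-2) * ((x - p) \<bullet> v))"
      unfolding dir_deriv_const_mult[OF pole_fun.ln that] dir_deriv_ln_norm[OF that] ..
    finally show ?thesis using True by (simp add: \<theta>_def)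
  next
    case False
    then show ?thesis unfolding \<Phi>_def
      by (simp only: if_False dir_deriv_norm_powi[OF that]) (simp add: \<theta>_def algebra_simps)
  qed
  have h\<Phi>: "harmonic_on \<Phi> (UNIV - {p})"
    by (rule harmonic_on_if_gradient[OF \<Phi>, of "- \<theta>"]) (simp add: d(2) grad)
  have h\<kappa>: "harmonic_on (\<lambda>x. norm (x - p) powi (2 - int d)) (UNIV - {p})"
    by (rule harmonic_on_if_gradient[where c = "2 - real d", OF pole_fun.pow]) (simp add: d(2) dir_deriv_norm_powi)
  note \<Phi>l = pole_fun_dir_deriv_funpow[OF \<Phi>, where v = \<eta>]
  note D = pole_fun.mult[OF pole_fun.const \<Phi>l]
  show "harmonic_on (harmonic_H d m \<epsilon> q \<eta>) (UNIV - {(1 + \<epsilon>) *\<^sub>R \<eta>})"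
    unfolding H a_def[symmetric] p_def[symmetric]
    by (intro harmonic_on_add harmonic_on_sum harmonic_on_const_mult pole_fun_sum
        pole_fun.mult[OF pole_fun.const pole_fun.pow] D h\<kappa> \<Phi>l pole_fun.pow harmonic_on_dir_deriv_funpow[OF \<Phi> h\<Phi>])
  assume x: "norm x = 1"
  have "x \<noteq> p" using x \<eta> a by (auto simp: p_def)
  define r where "r = norm (x - p)"
  have r: "r > 0" using \<open>x \<noteq> p\<close> by (simp add: r_def)
  define \<kappa> where "\<kappa> = r powi (2 - int d)"
  define A where "A = a\<^sup>2 * \<delta>\<^sup>2 / r\<^sup>2"
  have "C l * (dir_deriv \<eta> ^^ l) \<Phi> x = \<kappa> * (q l * (fps_nth (taylor_fps d \<delta> A m) l / \<delta>))" if "l \<in> {1..m}" for l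
  proof -
    have *: "a ^ l * \<delta> ^ l / fact l * (dir_deriv \<eta> ^^ l) \<Phi> x = \<theta> * \<kappa> * fps_nth (taylor_fps d \<delta> A m) l"
      using dir_deriv_iterates_eq_taylor_fps[OF \<Phi>[unfolded p_def] \<eta> x a \<theta> grad[unfolded p_def], where l = l and N = m] that
      by (simp add: \<kappa>_def A_def r_def \<delta>_def p_def)
    have "C l * (dir_deriv \<eta> ^^ l) \<Phi> x = q l / \<delta> / \<theta> * (a ^ l * \<delta> ^ l / fact l * (dir_deriv \<eta> ^^ l) \<Phi> x)"
      using that \<delta> by (cases l) (simp_all add: C_def mult_ac)
    also have "\<dots> = \<kappa> * (q l * (fps_nth (taylor_fps d \<delta> A m) l / \<delta>))" unfolding * using \<theta> by simp
    finally show ?thesis .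
  qed
  then have "harmonic_H d m \<epsilon> q \<eta> x = \<kappa> * (q 0 + (\<Sum>l=1..m. q l * (fps_nth (taylor_fps d \<delta> A m) l / \<delta>)))"
    unfolding H \<kappa>_def r_def by (simp add: distrib_left sum_distrib_left mult.commute)
  also have "\<dots> = \<kappa> * (pochhammer (real d / 2) (m - 1) / (2 * fact m) * A ^ m / \<delta>)"
    using coeff_system_sum[OF q[folded a_def, folded \<delta>_def] \<delta> m, of A] by simp
  also have "A ^ m = a ^ (2 * m) * \<delta> ^ (2 * m) / r ^ (2 * m)"
    by (simp only: A_def power_divide power_mult_distrib power_mult)
  also have "\<kappa> * (pochhammer (real d / 2) (m - 1) / (2 * fact m) * (a ^ (2 * m) * \<delta> ^ (2 * m) / r ^ (2 * m)) / \<delta>) =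
      pochhammer (real d / 2) (m - 1) / (2 * fact m) * a ^ (2 * m) * (\<delta> ^ (2 * m) / \<delta>) * (\<kappa> / r ^ (2 * m))"
    by (simp add: mult_ac)
  also have "\<delta> ^ (2 * m) / \<delta> = \<delta> ^ (2 * m - 1)" using \<delta> m power_diff[of \<delta> 1 "2 * m"] by simp
  also have "\<kappa> / r ^ (2 * m) = r powi (- int d + 2 - 2 * int m)"
  proof -
    have "r powi (2 - int d - int (2 * m)) = \<kappa> / r powi int (2 * m)"
      unfolding \<kappa>_def using r by (intro power_int_diff) simp
    moreover have "2 - int d - int (2 * m) = - int d + 2 - 2 * int m" by simp
    ultimately show ?thesis by (simp only: power_int_of_nat)
  qed
  also have "pochhammer (real d / 2) (m - 1) / (2 * fact m) * a ^ (2 * m) * \<delta> ^ (2 * m - 1) * \<dots> = kernel_F d m \<epsilon> (x \<bullet> \<eta>)"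
    using kernel_F_on_sphere[OF x \<eta> \<epsilon>, of d m] by (simp add: a_def \<delta>_def r_def p_def)
  finally show "harmonic_H d m \<epsilon> q \<eta> x = kernel_F d m \<epsilon> (x \<bullet> \<eta>)" .
qed

theorem theorem3p1:
  fixes m d :: nat
  assumes "m \<ge> 1" and "d \<ge> 2" and "CARD('n::finite) = d"
  shows "\<exists>c1>0. \<exists>c2>0. \<forall>\<eta>\<in>sphere (0 :: real ^ 'n) 1. \<forall>\<epsilon>. 0 < \<epsilon> \<and> \<epsilon> \<le> 1 \<longrightarrow>
    (let a = 1 + \<epsilon>; \<delta> = 1 - 1 / a ^ 2; F = kernel_F d m \<epsilon> in
      (\<forall>x\<in>sphere 0 1. F (x \<bullet> \<eta>) =
         pochhammer (real d / 2) (m - 1) / (2 * fact m) * a ^ (2 * m) * \<delta> ^ (2 * m - 1) *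
         norm (x - a *\<^sub>R \<eta>) powi (- int d + 2 - 2 * int m)) \<and>
      (\<forall>x\<in>sphere 0 1. 0 < F (x \<bullet> \<eta>) \<and>
         F (x \<bullet> \<eta>) \<le> c1 * \<epsilon> powi (- int d + 1) /
                        (1 + geodesic_dist x \<eta> / \<epsilon>) ^ (2 * m + d - 2)) \<and>
      integrable sphere_measure (\<lambda>x. F (x \<bullet> \<eta>)) \<and>
      (\<integral>x. F (x \<bullet> \<eta>) \<partial>sphere_measure) \<ge> c2 \<and>
      (\<exists>!q. q \<in> extensional {0..m} \<and> coeff_system d m \<delta> q) \<and>
      (\<forall>q. coeff_system d m \<delta> q \<longrightarrow>
         harmonic_on (harmonic_H d m \<epsilon> q \<eta>) (UNIV - {a *\<^sub>R \<eta>}) \<and>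
         (\<forall>x\<in>sphere 0 1. F (x \<bullet> \<eta>) = harmonic_H d m \<epsilon> q \<eta> x)))"
proof -
  note m = assms(1) and d = assms(2)
  have dim: "DIM(real ^ 'n) = d" using assms(3) by simp
  define c1 where "c1 = kernel_const d m * 2 ^ (2 * m) * 2 ^ (2 * m - 1) * 4 ^ (2 * m + d - 2)"
  define c2 where "c2 = kernel_const d m * (3 / 4) ^ (2 * m - 1) / 2 ^ (2 * m + d - 2) *
      (real d * unit_ball_vol (real d) / (2 * 8 ^ d))"
  have "c1 > 0" "c2 > 0"
    using kernel_const_pos[of d m] d by (simp_all add: c1_def c2_def)
  show ?thesis
    unfolding Let_def
  proof (rule exI[of _ c1], rule conjI[OF \<open>c1 > 0\<close>], rule exI[of _ c2], rule conjI[OF \<open>c2 > 0\<close>],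
      intro ballI allI impI conjI)
    fix \<eta> x :: "real ^ 'n" and \<epsilon> :: real
    assume "\<eta> \<in> sphere 0 1" and \<epsilon>: "0 < \<epsilon> \<and> \<epsilon> \<le> 1"
    then have \<eta>: "norm \<eta> = 1" by simp
    note \<epsilon>1 = conjunct1[OF \<epsilon>] and \<epsilon>2 = conjunct2[OF \<epsilon>]
    show "integrable sphere_measure (\<lambda>x. kernel_F d m \<epsilon> (x \<bullet> \<eta>))"
      by (rule integrable_kernel_F[OF \<eta> \<epsilon>1 \<epsilon>2 d m])
    show "c2 \<le> (\<integral>x. kernel_F d m \<epsilon> (x \<bullet> \<eta>) \<partial>sphere_measure)"
      unfolding c2_def by (rule integral_kernel_F_ge[OF \<eta> \<epsilon>1 \<epsilon>2 d dim m])
    show "\<exists>!q. q \<in> extensional {0..m} \<and> coeff_system d m (1 - 1 / (1 + \<epsilon>)\<^sup>2) q"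
      by (rule coeff_system_unique_solution[OF m])
    {
      assume "x \<in> sphere 0 1"
      then have x: "norm x = 1" by simp
      show "kernel_F d m \<epsilon> (x \<bullet> \<eta>) = pochhammer (real d / 2) (m - 1) / (2 * fact m) * (1 + \<epsilon>) ^ (2 * m) *
          (1 - 1 / (1 + \<epsilon>)\<^sup>2) ^ (2 * m - 1) * norm (x - (1 + \<epsilon>) *\<^sub>R \<eta>) powi (- int d + 2 - 2 * int m)"
        by (rule kernel_F_on_sphere[OF x \<eta> \<epsilon>1])
      show "0 < kernel_F d m \<epsilon> (x \<bullet> \<eta>)" by (rule kernel_F_pos[OF x \<eta> \<epsilon>1 \<epsilon>2 d m])
      show "kernel_F d m \<epsilon> (x \<bullet> \<eta>) \<le> c1 * \<epsilon> powi (- int d + 1) / (1 + geodesic_dist x \<eta> / \<epsilon>) ^ (2 * m + d - 2)"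
        unfolding c1_def by (rule kernel_F_le[OF x \<eta> \<epsilon>1 \<epsilon>2 d m])
    }
    fix q assume q: "coeff_system d m (1 - 1 / (1 + \<epsilon>)\<^sup>2) q"
    show "harmonic_on (harmonic_H d m \<epsilon> q \<eta>) (UNIV - {(1 + \<epsilon>) *\<^sub>R \<eta>})"
      by (rule harmonic_on_harmonic_H[OF d dim \<eta> \<epsilon>1 q m])
    assume "x \<in> sphere 0 1"
    then have x: "norm x = 1" by simp
    show "kernel_F d m \<epsilon> (x \<bullet> \<eta>) = harmonic_H d m \<epsilon> q \<eta> x"
      by (rule harmonic_H_on_sphere[OF d dim \<eta> \<epsilon>1 q m x, symmetric])
  qed
qed

end
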